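(* Let $m,n\in\mathbb{R}^+\cup\{0\}$ and $f\in D_{HK}$. Then (i) $\mathcal{J}_a^m\mathcal{J}_a^nf=\mathcal{J}_a^{m+n}f$ in $D_{HK}$; moreover, if $m\geq1$ or $n\geq 1$, the identity holds at every point of $[a,b]$ as an identity of continuous functions; (ii) $\mathcal{J}_a^m\mathcal{J}_a^nf=\mathcal{J}_a^n\mathcal{J}_a^mf$ in $D_{HK}$; (iii) the set $\{\mathcal{J}_a^n:D_{HK}\to D_{HK},\ n\geq0\}$ forms a commutative semigroup with respect to composition, with the identity operator $\mathcal{J}_a^0$ as neutral element.
   Context: Fix real numbers $a<b$. $\mathcal{D}(a,b)$ is the space of real $C^\infty$ functions with compact support in $(a,b)$, $\mathcal{D}'(a,b)$ the space of distributions on $(a,b)$, $D$ the distributional derivative. Let $C_0=\{F\in C[a,b]:F(a)=0\}$. A distribution $f\in\mathcal{D}'(a,b)$ is Henstock–Kurzweil integrable if there is $F\in C_0$ with $DF=f$ (such $F$ is unique, the primitive of $f$), and its distributional Henstock–Kurzweil integral is $\int_c^d f=F(d)-F(c)$. $D_{HK}$ is the space of these distributions with the Alexiewicz norm $\|f\|_A=\sup_{x\in[a,b]}|F(x)|$; it is a Banach space containing $L^1[a,b]$ as a dense subspace. Riemann–Liouville fractional integral on $D_{HK}$: for $n\ge 1$, $\mathcal{J}_a^nf(x)=\frac{1}{\Gamma(n)}\int_a^x(x-t)^{n-1}f(t)\,dt$ for $a\le x\le b$ (distributional Henstock–Kurzweil integral; for $n\ge1$ this is a continuous function on $[a,b]$);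 for $0<n<1$, $\mathcal{J}_a^nf(x)=\frac{1}{\Gamma(n)}\lim_{k\to\infty}\int_a^x(x-t)^{n-1}f_k(t)\,dt$, where $(f_k)\subset L^1[a,b]$ with $\|f_k-f\|_A\to0$; $\mathcal{J}_a^0$ is the identity. These operators map $D_{HK}$ into $D_{HK}$. *)

theory Defs
  imports "HOL-Analysis.Analysis"
begin

definition test_fn :: "real \<Rightarrow> real \<Rightarrow> (real \<Rightarrow> real) \<Rightarrow> bool" where
  "test_fn a b \<phi> \<longleftrightarrow>
     (\<forall>k x. ((deriv ^^ k) \<phi>) differentiable (at x)) \<and>
     (\<exists>c d. a < c \<and> c \<le> d \<and> d < b \<and> (\<forall>x. x \<notin> {c..d} \<longrightarrow> \<phi> x = 0))"

text \<open>A distribution on (a,b) is represented by its action on test functions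
  (normalised to 0 on non-test functions, so that HOL equality is equality of distributions).\<close>
type_synonym distr = "(real \<Rightarrow> real) \<Rightarrow> real"

definition C0 :: "real \<Rightarrow> real \<Rightarrow> (real \<Rightarrow> real) set" where
  "C0 a b = {F. continuous_on {a..b} F \<and> F a = 0}"

definition distD :: "real \<Rightarrow> real \<Rightarrow> (real \<Rightarrow> real) \<Rightarrow> distr" where
  "distD a b F = (\<lambda>\<phi>. if test_fn a b \<phi> then - integral {a..b} (\<lambda>t. F t * deriv \<phi> t) else 0)"

definition DHK :: "real \<Rightarrow> real \<Rightarrow> distr set" where
  "DHK a b = {f. \<exists>F \<in> C0 a b. distD a b F = f}"

text \<open>The primitive (unique on [a,b]).\<close>
definition primitive :: "real \<Rightarrow> real \<Rightarrow> distr \<Rightarrow> real \<Rightarrow> real" where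
  "primitive a b f = (SOME F. F \<in> C0 a b \<and> distD a b F = f)"

definition dhk_integral :: "real \<Rightarrow> real \<Rightarrow> distr \<Rightarrow> real \<Rightarrow> real \<Rightarrow> real" where
  "dhk_integral a b f c d = primitive a b f d - primitive a b f c"

definition alex_norm :: "real \<Rightarrow> real \<Rightarrow> distr \<Rightarrow> real" where
  "alex_norm a b f = (SUP x\<in>{a..b}. \<bar>primitive a b f x\<bar>)"

definition dminus :: "distr \<Rightarrow> distr \<Rightarrow> distr" where
  "dminus f g = (\<lambda>\<phi>. f \<phi> - g \<phi>)"

definition L1 :: "real \<Rightarrow> real \<Rightarrow> (real \<Rightarrow> real) set" where
  "L1 a b = {g. g absolutely_integrable_on {a..b}}"

definition embed :: "real \<Rightarrow> real \<Rightarrow> (real \<Rightarrow> real) \<Rightarrow> distr" where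
  "embed a b g = (\<lambda>\<phi>. if test_fn a b \<phi> then integral {a..b} (\<lambda>t. g t * \<phi> t) else 0)"

text \<open>Distributional HK integral over [c,d] of the product f*g of f in D_HK with an absolutely
  continuous (in particular BV) function g, via integration by parts:
  F(d)g(d) - F(c)g(c) - int_c^d F dg, where dg = g' dt for absolutely continuous g.\<close>
definition dhk_int_mul :: "real \<Rightarrow> real \<Rightarrow> distr \<Rightarrow> (real \<Rightarrow> real) \<Rightarrow> real \<Rightarrow> real \<Rightarrow> real" where
  "dhk_int_mul a b f g c d =
     primitive a b f d * g d - primitive a b f c * g c
     - integral {c..d} (\<lambda>t. primitive a b f t * deriv g t)"

text \<open>Kernel (x-t)^(n-1) with the convention 0^0 = 1.\<close>
definition RL_kernel :: "real \<Rightarrow> real \<Rightarrow> real \<Rightarrow> real" where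
  "RL_kernel n x t = (if n = 1 then 1 else (x - t) powr (n - 1))"

definition RL_fun :: "real \<Rightarrow> real \<Rightarrow> real \<Rightarrow> distr \<Rightarrow> real \<Rightarrow> real" where
  "RL_fun a b n f x = (1 / Gamma n) * dhk_int_mul a b f (RL_kernel n x) a x"

definition RL_L1 :: "real \<Rightarrow> real \<Rightarrow> real \<Rightarrow> (real \<Rightarrow> real) \<Rightarrow> real \<Rightarrow> real" where
  "RL_L1 a b n g x = (1 / Gamma n) * integral {a..x} (\<lambda>t. (x - t) powr (n - 1) * g t)"

definition RL :: "real \<Rightarrow> real \<Rightarrow> real \<Rightarrow> distr \<Rightarrow> distr" where
  "RL a b n f =
    (if n = 0 then f
     else if 1 \<le> n then embed a b (RL_fun a b n f)
     else (THE h. h \<in> DHK a b \<and>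
            (\<forall>fk :: nat \<Rightarrow> real \<Rightarrow> real.
               (\<forall>k. fk k \<in> L1 a b) \<and>
               (\<lambda>k. alex_norm a b (dminus (embed a b (fk k)) f)) \<longlonglongrightarrow> 0 \<longrightarrow>
               (\<lambda>k. alex_norm a b (dminus (embed a b (RL_L1 a b n (fk k))) h)) \<longlonglongrightarrow> 0)))"

end

(* For continuous F vanishing at a, the fractional integral I^n F is again continuous and vanishes
   at a, and I^m I^n F = I^(m+n) F by Fubini and the Beta integral.  With F the primitive of f, the
   primitive of J^n f is I^n F: for n >= 1 by integration by parts, and for 0 < n < 1 because I^n is
   bounded for the sup norm and commutes with I^1 on L^1.  In the latter case the limit determines
   J^n f since polynomials, hence primitives of L^1 functions, are dense in C0.  Everything is thus
   carried by primitives, which are unique by the du Bois-Reymond lemma. *)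

theory Submission
  imports Defs
begin

section \<open>Uniqueness of primitives\<close>

text \<open>An element of D_HK is a functional, so an identity between distributions reduces to one
  between primitives on \<open>{a..b}\<close>; off that interval \<open>primitive\<close> is
  arbitrary, being picked by SOME, and values are compared only there. Orders are shifted by one
  between two levels: for n >= 1 the function behind J^n f is I^(n-1) F, while the primitive of J^n
  f is I^n F. The kernel is extended by zero to the whole line, which turns integrals over varying
  intervals into convolutions and leaves Fubini no domains to track. The obstacle is that an inner
  fractional integral of an L1 function may diverge on a null set. Every pointwise composition law
  therefore rests on integrability of the single convolution of order p + q, which is available
  either because the function is bounded or because p + q >= 1. For 0 < n < 1 the definition
  quantifies over all approximating sequences, so convergence along each of them and the existence
  of at least one are both required.\<close>

definition flat_exp :: "real poly \<Rightarrow> real \<Rightarrow> real" where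
  "flat_exp P x = (if 0 < x then poly P (1 / x) * exp (- (1 / x)) else 0)"

lemma tendsto_poly_mult_exp_minus:
  fixes P :: "real poly"
  shows "((\<lambda>y. poly P y * exp (- y)) \<longlongrightarrow> 0) at_top"
proof -
  have "((\<lambda>y. \<Sum>i\<le>degree P. coeff P i * (y ^ i / exp y)) \<longlongrightarrow> (\<Sum>i\<le>degree P. coeff P i * 0)) at_top"
    by (intro tendsto_sum tendsto_mult tendsto_const tendsto_power_div_exp_0)
  moreover have "poly P y * exp (- y) = (\<Sum>i\<le>degree P. coeff P i * (y ^ i / exp y))" for y
    unfolding poly_altdef sum_distrib_right by (simp add: exp_minus divide_inverse mult.assoc)
  ultimately show ?thesis by simp
qed

text \<open>Put y = 1/x, so that d/dx = -y^2 d/dy. Then P(y) exp(-y) becomes y^2 (P - P')(y)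
  exp(-y), and \<open>[:0, 0, 1:]\<close> is y^2. The polynomial parameter thus keeps all
  derivatives inside one family.\<close>

lemma flat_exp_has_derivative:
  "(flat_exp P has_real_derivative flat_exp ([:0, 0, 1:] * (P - pderiv P)) x) (at x)"
proof -
  consider "x < 0" | "x = 0" | "x > 0" by linarith
  then show ?thesis
  proof cases
    case 1
    have "\<forall>\<^sub>F y in nhds x. flat_exp P y = 0"
      using 1 eventually_nhds_in_open[of "{..<0}" x]
      by (auto simp: flat_exp_def elim!: eventually_mono)
    then have "(flat_exp P has_real_derivative 0) (at x) \<longleftrightarrow> ((\<lambda>_. 0) has_real_derivative 0) (at x)"
      by (intro DERIV_cong_ev) auto
    with 1 show ?thesis by (simp add: flat_exp_def)
  next
    case 2
    \<comment> \<open>Dividing by h multiplies the polynomial in 1/h by its variable, hence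
      \<open>pCons 0 P\<close>; exponential decay then kills the difference quotient from the
      right.\<close>
    have "((\<lambda>h. poly (pCons 0 P) (1 / h) * exp (- (1 / h))) \<longlongrightarrow> 0) (at_right 0)"
      using filterlim_compose[OF tendsto_poly_mult_exp_minus[of "pCons 0 P"] filterlim_inverse_at_top_right]
      by (simp add: inverse_eq_divide)
    moreover have "\<forall>\<^sub>F h in at_right 0. poly (pCons 0 P) (1 / h) * exp (- (1 / h)) = flat_exp P h / h"
      by (auto simp: flat_exp_def eventually_at_right_less eventually_at_filter)
    ultimately have r: "((\<lambda>h. flat_exp P h / h) \<longlongrightarrow> 0) (at_right 0)"
      by (rule Lim_transform_eventually)
    have "\<forall>\<^sub>F h in at_left 0. 0 = flat_exp P h / h"
      by (auto simp: flat_exp_def eventually_at_filter)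
    then have l: "((\<lambda>h. flat_exp P h / h) \<longlongrightarrow> 0) (at_left 0)"
      by (rule Lim_transform_eventually[OF tendsto_const])
    show ?thesis
      using filterlim_split_at[OF l r] 2
      by (simp add: has_field_derivative_iff flat_exp_def)
  next
    case 3
    have "\<forall>\<^sub>F y in nhds x. flat_exp P y = poly P (1 / y) * exp (- (1 / y))"
      using 3 eventually_nhds_in_open[of "{0<..}" x]
      by (auto simp: flat_exp_def elim!: eventually_mono)
    moreover have "((\<lambda>y. poly P (1 / y) * exp (- (1 / y))) has_real_derivative
        flat_exp ([:0, 0, 1:] * (P - pderiv P)) x) (at x)"
      using 3 by (auto intro!: derivative_eq_intros DERIV_chain'[OF _ poly_DERIV]
          simp: flat_exp_def field_simps)
    ultimately show ?thesis
      by (subst DERIV_cong_ev) auto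
  qed
qed

text \<open>\<open>test_fn\<close> demands differentiability of every iterate of
  \<open>deriv\<close>, so it is checked on a class that \<open>deriv\<close> maps into itself. Each
  product lives on \<open>{u..v}\<close>; sums absorb both the product rule and the combination of
  two bumps.\<close>

inductive bump_sum :: "(real \<Rightarrow> real) \<Rightarrow> bool" where
  prod: "bump_sum (\<lambda>t. c * (flat_exp P (t - u) * flat_exp Q (v - t)))"
| add: "bump_sum f \<Longrightarrow> bump_sum g \<Longrightarrow> bump_sum (\<lambda>t. f t + g t)"

lemma bump_sum_has_derivative:
  assumes "bump_sum f"
  shows "\<exists>g. bump_sum g \<and> (\<forall>x. (f has_real_derivative g x) (at x))"
  using assms
proof induction
  case (prod c P u Q v)
  let ?D = "\<lambda>P. [:0, 0, 1:] * (P - pderiv P)"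
  let ?g = "\<lambda>t. c * (flat_exp (?D P) (t - u) * flat_exp Q (v - t))
    + (- c) * (flat_exp P (t - u) * flat_exp (?D Q) (v - t))"
  have "bump_sum ?g"
    by (intro bump_sum.intros)
  moreover have "((\<lambda>t. c * (flat_exp P (t - u) * flat_exp Q (v - t))) has_real_derivative ?g x) (at x)" for x
    by (rule derivative_eq_intros DERIV_chain'[OF _ flat_exp_has_derivative] refl
      | simp add: algebra_simps)+
  ultimately show ?case by blast
next
  case (add f g)
  then obtain f' g' where "bump_sum f'" "bump_sum g'"
    "\<forall>x. (f has_real_derivative f' x) (at x)" "\<forall>x. (g has_real_derivative g' x) (at x)"
    by blast
  then show ?case
    by (intro exI[of _ "\<lambda>t. f' t + g' t"]) (auto intro: bump_sum.add DERIV_add)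
qed

lemma bump_sum_deriv:
  assumes "bump_sum f"
  shows "bump_sum (deriv f)"
proof -
  obtain g where "bump_sum g" and g: "\<And>x. (f has_real_derivative g x) (at x)"
    using bump_sum_has_derivative[OF assms] by blast
  moreover have "deriv f = g"
    using g by (intro ext DERIV_imp_deriv)
  ultimately show ?thesis by simp
qed

lemma bump_sum_differentiable: "bump_sum f \<Longrightarrow> f differentiable (at x)"
  unfolding real_differentiable_def using bump_sum_has_derivative[of f] by blast

lemma bump_sum_funpow_deriv: "bump_sum f \<Longrightarrow> bump_sum ((deriv ^^ k) f)"
  by (induction k) (auto intro: bump_sum_deriv)

lemma bump_sum_continuous_on: "bump_sum f \<Longrightarrow> continuous_on A f"
  by (intro continuous_at_imp_continuous_on ballI differentiable_imp_continuous_within bump_sum_differentiable)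

text \<open>Zero total mass is what makes the antiderivative vanish to the right of \<open>d\<close>
  as well as to the left of \<open>c\<close>. Its higher derivatives are iterated derivatives of
  \<open>f\<close>.\<close>

lemma test_fn_bump_antiderivative:
  assumes f: "bump_sum f" and cd: "a < c" "c \<le> d" "d < b"
    and supp: "\<And>t. t \<notin> {c..d} \<Longrightarrow> f t = 0" and zero: "integral {a..b} f = 0"
  defines "\<phi> \<equiv> \<lambda>t. integral {a..t} f"
  shows "test_fn a b \<phi>" and "deriv \<phi> = f"
proof -
  have left: "\<phi> t = 0" if "t < c" for t
    using that unfolding \<phi>_def by (intro integral_unique has_integral_is_0) (auto intro!: supp)
  have right: "\<phi> t = 0" if "d < t" for t
  proof -
    have "integral {d..t} f = 0" if "d \<le> t" for t
      by (rule integral_spike[of "{d}" _ _ "\<lambda>_. 0", simplified]) (auto intro!: supp)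
    moreover have "integral {a..t} f = integral {a..d} f + integral {d..t} f" if "d \<le> t" for t
      using that cd by (intro Henstock_Kurzweil_Integration.integral_combine[symmetric] integrable_continuous_interval bump_sum_continuous_on f) auto
    ultimately show ?thesis
      using zero that cd unfolding \<phi>_def by (metis add.right_neutral less_imp_le)
  qed
  have D: "(\<phi> has_real_derivative f t) (at t)" for t
  proof (cases "t < c")
    case True
    have "\<forall>\<^sub>F y in nhds t. \<phi> y = 0"
      using True eventually_nhds_in_open[of "{..<c}" t] by (auto intro: left elim!: eventually_mono)
    then have "(\<phi> has_real_derivative 0) (at t) \<longleftrightarrow> ((\<lambda>_. 0) has_real_derivative 0) (at t)"
      by (intro DERIV_cong_ev) auto
    with True supp show ?thesis by simp
  next
    \<comment> \<open>Here t >= c > a, so t is interior to \<open>{a..t + 1}\<close> and the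
      derivative within that interval is a two-sided one.\<close>
    case False
    have "(\<phi> has_real_derivative f t) (at t within {a..t + 1})"
      unfolding \<phi>_def using False cd
      by (intro integral_has_real_derivative bump_sum_continuous_on f) auto
    moreover have "t \<in> interior {a..t + 1}"
      using False cd by (simp add: interior_atLeastAtMost_real)
    ultimately show ?thesis
      by (simp only: at_within_interior)
  qed
  then show d: "deriv \<phi> = f"
    by (auto intro: DERIV_imp_deriv)
  have "((deriv ^^ k) \<phi>) differentiable (at x)" for k x
  proof (cases k)
    case 0
    then show ?thesis unfolding real_differentiable_def using D by auto
  next
    case (Suc j)
    then have "(deriv ^^ k) \<phi> = (deriv ^^ j) f"
      by (simp add: funpow_Suc_right d del: funpow.simps)
    then show ?thesis
      using bump_sum_differentiable[OF bump_sum_funpow_deriv[OF f]] by simp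
  qed
  moreover have "\<phi> x = 0" if "x \<notin> {c..d}" for x
    using that left right by force
  ultimately show "test_fn a b \<phi>"
    using cd unfolding test_fn_def by blast
qed

definition bump :: "real \<Rightarrow> real \<Rightarrow> real \<Rightarrow> real" where
  "bump u v t = flat_exp 1 (t - u) * flat_exp 1 (v - t)"

lemma bump_nonneg: "0 \<le> bump u v t"
  by (simp add: bump_def flat_exp_def)

lemma bump_eq_0: "t \<notin> {u<..<v} \<Longrightarrow> bump u v t = 0"
  by (auto simp: bump_def flat_exp_def)

lemma bump_sum_bump: "bump_sum (\<lambda>t. c * bump u v t)"
  unfolding bump_def by (rule bump_sum.prod)

lemma bump_continuous_on: "continuous_on A (bump u v)"
  using bump_sum_continuous_on[OF bump_sum_bump[of 1 u v]] by simp

lemma integral_bump_pos: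
  assumes "a \<le> u" "u < v" "v \<le> b"
  shows "0 < integral {a..b} (bump u v)"
proof -
  have "integral {a..b} (bump u v) \<noteq> 0"
  proof
    assume "integral {a..b} (bump u v) = 0"
    then have "bump u v ((u + v) / 2) = 0"
      using assms by (intro integral_eq_0_iff[of a b "bump u v", THEN iffD1, rule_format])
        (auto intro: bump_continuous_on bump_nonneg)
    with assms show False
      by (simp add: bump_def flat_exp_def)
  qed
  moreover have "0 \<le> integral {a..b} (bump u v)"
    by (intro integral_nonneg integrable_continuous_interval bump_continuous_on bump_nonneg)
  ultimately show ?thesis by simp
qed

text \<open>Testing against the antiderivative of a difference of two bumps, scaled to equal mass,
  compares the values of \<open>H\<close> near two points.\<close>
lemma du_Bois_Reymond_aux:
  fixes H :: "real \<Rightarrow> real"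
  assumes H: "continuous_on {a..b} H"
    and test: "\<And>\<phi>. test_fn a b \<phi> \<Longrightarrow> integral {a..b} (\<lambda>t. H t * deriv \<phi> t) = 0"
    and x: "a < x" "x < b" and y: "a < y" "y < b"
  shows "H x \<le> H y"
proof (rule ccontr)
  assume "\<not> H x \<le> H y"
  define m where "m = (H x + H y) / 2"
  have m: "H y < m" "m < H x" using \<open>\<not> H x \<le> H y\<close> by (auto simp: m_def)
  have cont: "isCont H t" if "a < t" "t < b" for t
    using H that continuous_on_interior[of "{a..b}" H t] by (simp add: interior_atLeastAtMost_real)
  have "\<forall>\<^sub>F t in nhds x. m < H t" "\<forall>\<^sub>F t in nhds y. H t < m"
    using order_tendstoD[OF cont[unfolded isCont_def]] m x y
    by (auto simp: eventually_nhds_conv_at)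
  then obtain d1 d2 where d: "0 < d1" "0 < d2" "\<And>t. \<bar>t - x\<bar> < d1 \<Longrightarrow> m < H t" "\<And>t. \<bar>t - y\<bar> < d2 \<Longrightarrow> H t < m"
    unfolding eventually_nhds_metric dist_real_def by metis
  \<comment> \<open>Small enough that \<open>H\<close> stays above \<open>m\<close> on the bump at x
    and below \<open>m\<close> on the bump at y; the halves keep both supports strictly inside the
    open interval.\<close>
  define e where "e = Min {d1, d2, (x - a) / 2, (b - x) / 2, (y - a) / 2, (b - y) / 2}"
  have e: "0 < e" "e \<le> d1" "e \<le> d2" "e \<le> (x - a) / 2" "e \<le> (b - x) / 2" "e \<le> (y - a) / 2" "e \<le> (b - y) / 2"
    using d x y unfolding e_def by (auto simp: min_def)
  let ?p = "bump (x - e) (x + e)" and ?q = "bump (y - e) (y + e)"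
  define A B where "A = integral {a..b} ?p" and "B = integral {a..b} ?q"
  have A: "0 < A" and B: "0 < B"
    unfolding A_def B_def using e x y by (auto intro!: integral_bump_pos)
  define f where "f = (\<lambda>t. B * ?p t + (- A) * ?q t)"
  have f: "bump_sum f"
    unfolding f_def by (intro bump_sum.add bump_sum_bump)
  have int: "h integrable_on {a..b}" if "continuous_on {a..b} h" for h :: "real \<Rightarrow> real"
    using that by (rule integrable_continuous_interval)
  note ci = continuous_intros bump_continuous_on H
  have zero: "integral {a..b} f = 0"
  proof -
    have "integral {a..b} f = integral {a..b} (\<lambda>t. B * ?p t) + integral {a..b} (\<lambda>t. (- A) * ?q t)"
      unfolding f_def by (intro Henstock_Kurzweil_Integration.integral_add int ci)
    then show ?thesis
      by (simp add: A_def B_def)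
  qed
  define c d where "c = min x y - e" and "d = max x y + e"
  have cd: "a < c" "c \<le> d" "d < b"
    using e x y by (auto simp: c_def d_def min_def max_def)
  have supp: "f t = 0" if "t \<notin> {c..d}" for t
  proof -
    have "t < x - e \<or> x + e < t" "t < y - e \<or> y + e < t"
      using that unfolding c_def d_def atLeastAtMost_iff by linarith+
    then have "t \<notin> {x - e<..<x + e}" "t \<notin> {y - e<..<y + e}" by auto
    then show ?thesis by (simp add: f_def bump_eq_0)
  qed
  note tf = test_fn_bump_antiderivative[OF f cd supp zero]
  have "integral {a..b} (\<lambda>t. H t * f t) = 0"
    using test[OF tf(1)] tf(2) by simp
  moreover have "0 < integral {a..b} (\<lambda>t. H t * f t)"
  proof -
    \<comment> \<open>On the bump at x both factors are nonnegative, on the bump at y both signs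
      flip. Subtracting \<open>m\<close> from \<open>H\<close> costs nothing, since \<open>f\<close>
      has zero mass.\<close>
    have pos: "(H t - m) * f t \<ge> 0" for t
    proof -
      have "(H t - m) * ?p t \<ge> 0"
      proof (cases "t \<in> {x - e<..<x + e}")
        case True
        then have "\<bar>t - x\<bar> < d1" using e(2) unfolding greaterThanLessThan_iff by linarith
        then show ?thesis using d(3)[of t] bump_nonneg by simp
      qed (simp add: bump_eq_0)
      moreover have "(H t - m) * ?q t \<le> 0"
      proof (cases "t \<in> {y - e<..<y + e}")
        case True
        then have "\<bar>t - y\<bar> < d2" using e(3) unfolding greaterThanLessThan_iff by linarith
        then show ?thesis using d(4)[of t] bump_nonneg by (simp add: mult_nonpos_nonneg)
      qed (simp add: bump_eq_0)
      ultimately have "B * ((H t - m) * ?p t) \<ge> 0" "A * ((H t - m) * ?q t) \<le> 0"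
        using A B by (simp_all add: mult_nonneg_nonpos)
      then show ?thesis
        unfolding f_def by (simp add: algebra_simps)
    qed
    have fx: "(H x - m) * f x > 0"
    proof -
      \<comment> \<open>At x the bump at y contributes nothing, because \<open>H\<close> lies below
        \<open>m\<close> on its support but above \<open>m\<close> at x.\<close>
      have "?q x = 0"
      proof (rule bump_eq_0, rule)
        assume "x \<in> {y - e<..<y + e}"
        then have "\<bar>x - y\<bar> < d2" using e(3) unfolding greaterThanLessThan_iff by linarith
        then have "H x < m" by (rule d(4))
        with m show False by simp
      qed
      moreover have "?p x > 0" using e by (simp add: bump_def flat_exp_def)
      ultimately show ?thesis using m B by (simp add: f_def)
    qed
    have c1: "continuous_on {a..b} (\<lambda>t. (H t - m) * f t)"
      unfolding f_def by (intro ci)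
    have "integral {a..b} (\<lambda>t. (H t - m) * f t) \<noteq> 0"
    proof
      assume "integral {a..b} (\<lambda>t. (H t - m) * f t) = 0"
      then have "(H x - m) * f x = 0"
        using integral_eq_0_iff[OF c1] pos x by simp
      with fx show False by linarith
    qed
    then have "0 < integral {a..b} (\<lambda>t. (H t - m) * f t)"
      using integral_nonneg[OF int[OF c1] pos] by linarith
    also have "integral {a..b} (\<lambda>t. (H t - m) * f t) = integral {a..b} (\<lambda>t. H t * f t) - integral {a..b} (\<lambda>t. m * f t)"
      unfolding left_diff_distrib
      by (intro Henstock_Kurzweil_Integration.integral_diff int ci bump_sum_continuous_on[OF f])
    finally show ?thesis by (simp add: zero)
  qed
  ultimately show False by simp
qed

text \<open>Using \<open>du_Bois_Reymond_aux\<close> in both directions makes the difference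
  constant on the open interval. Continuity carries this to the end points, and the value 0 at
  \<open>a\<close> fixes the constant.\<close>

lemma distD_inject:
  assumes ab: "a < b" and F: "F \<in> C0 a b" and G: "G \<in> C0 a b" and eq: "distD a b F = distD a b G"
    and x: "x \<in> {a..b}"
  shows "F x = G x"
proof -
  define H where "H = (\<lambda>t. F t - G t)"
  have cF: "continuous_on {a..b} F" and cG: "continuous_on {a..b} G"
    using F G by (auto simp: C0_def)
  have cH: "continuous_on {a..b} H"
    unfolding H_def by (intro continuous_intros cF cG)
  have test: "integral {a..b} (\<lambda>t. H t * deriv \<phi> t) = 0" if "test_fn a b \<phi>" for \<phi>
  proof -
    have "deriv \<phi> differentiable (at t)" for t
      using that unfolding test_fn_def by (metis funpow_0 funpow_simps_right(2) o_apply)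
    then have cd: "continuous_on {a..b} (deriv \<phi>)"
      by (meson continuous_at_imp_continuous_on differentiable_imp_continuous_within)
    have "integral {a..b} (\<lambda>t. H t * deriv \<phi> t)
      = integral {a..b} (\<lambda>t. F t * deriv \<phi> t) - integral {a..b} (\<lambda>t. G t * deriv \<phi> t)"
      unfolding H_def left_diff_distrib
      by (intro Henstock_Kurzweil_Integration.integral_diff integrable_continuous_interval
          continuous_intros cF cG cd)
    with that fun_cong[OF eq, of \<phi>] show ?thesis
      by (simp add: distD_def)
  qed
  define c where "c = (a + b) / 2"
  have c: "a < c" "c < b" using ab by (auto simp: c_def)
  have in_open: "H t = H c" if "t \<in> {a<..<b}" for t
    using du_Bois_Reymond_aux[OF cH test] that c by (intro antisym) auto
  have "H t = H c" if "t \<in> {a..b}" for t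
    using continuous_constant_on_closure[of "{a<..<b}" H "H c" t] cH in_open that ab by simp
  from this[of x] this[of a] x ab F G show ?thesis
    by (simp add: H_def C0_def)
qed

lemma primitive_props:
  assumes "f \<in> DHK a b"
  shows primitive_in_C0: "primitive a b f \<in> C0 a b" and distD_primitive: "distD a b (primitive a b f) = f"
proof -
  have "\<exists>F. F \<in> C0 a b \<and> distD a b F = f"
    using assms unfolding DHK_def by blast
  from someI_ex[OF this] show "primitive a b f \<in> C0 a b" "distD a b (primitive a b f) = f"
    unfolding primitive_def by auto
qed

lemma distD_in_DHK: "F \<in> C0 a b \<Longrightarrow> distD a b F \<in> DHK a b"
  unfolding DHK_def by blast

lemma primitive_distD:
  "a < b \<Longrightarrow> F \<in> C0 a b \<Longrightarrow> x \<in> {a..b} \<Longrightarrow> primitive a b (distD a b F) x = F x"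
  by (rule distD_inject) (auto simp: primitive_in_C0 distD_primitive distD_in_DHK)

section \<open>Convolution with the Riemann-Liouville kernels\<close>

text \<open>The one-sided power function whose convolution is I^p. It vanishes for s <= 0, so the
  restriction t < x is carried by the kernel, and order 1 gives the indicator of the positive
  half-line.\<close>

definition frac_kernel :: "real \<Rightarrow> real \<Rightarrow> real" where
  "frac_kernel p s = (if 0 < s then s powr (p - 1) / Gamma p else 0)"

lemma frac_kernel_nonneg: "0 < p \<Longrightarrow> 0 \<le> frac_kernel p s"
  by (simp add: frac_kernel_def Gamma_real_nonneg)

lemma frac_kernel_measurable [measurable]: "frac_kernel p \<in> borel_measurable borel"
  unfolding frac_kernel_def by measurable

lemma frac_kernel_1: "frac_kernel 1 s = (if 0 < s then 1 else 0)"
  by (simp add: frac_kernel_def)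

lemma frac_kernel_mono: "1 \<le> p \<Longrightarrow> s \<le> t \<Longrightarrow> frac_kernel p s \<le> frac_kernel p t"
  by (auto simp: frac_kernel_def Gamma_real_nonneg intro!: divide_right_mono powr_mono2)

text \<open>The substitution s = t + L u with L = x - t produces the Beta integral, and its Jacobian
  L raises the exponent p + q - 2 to p + q - 1. The factor Beta q p / (Gamma p Gamma q) is 1 / Gamma
  (p + q). Nonnegativity turns the gauge integral into a Lebesgue one.\<close>

lemma has_bochner_integral_frac_kernel_mult:
  assumes p: "0 < p" and q: "0 < q"
  shows "has_bochner_integral lborel (\<lambda>s. frac_kernel p (x - s) * frac_kernel q (s - t)) (frac_kernel (p + q) (x - t))"
proof (cases "t < x")
  case False
  then have "(\<lambda>s. frac_kernel p (x - s) * frac_kernel q (s - t)) = (\<lambda>s. 0)"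
    by (auto simp: frac_kernel_def)
  with False show ?thesis
    by (simp add: has_bochner_integral_zero frac_kernel_def)
next
  case True
  define L where "L = x - t"
  have L: "0 < L" using True by (simp add: L_def)
  let ?b = "\<lambda>u. u powr (q - 1) * (1 - u) powr (p - 1)"
  let ?k = "\<lambda>s. frac_kernel p (x - s) * frac_kernel q (s - t)"
  have eq: "?b ((1 / L) *\<^sub>R s + (- t / L)) = ((s - t) powr (q - 1) * (x - s) powr (p - 1)) / L powr (p + q - 2)"
    if "s \<in> {t..x}" for s
  proof -
    have "(1 / L) *\<^sub>R s + (- t / L) = (s - t) / L"
      by (simp add: diff_divide_distrib)
    moreover have "1 - (s - t) / L = (L - (s - t)) / L"
      using L by (simp add: diff_divide_distrib)
    moreover have "L - (s - t) = x - s"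
      by (simp add: L_def)
    moreover have "L powr (q - 1) * L powr (p - 1) = L powr (p + q - 2)"
      by (simp add: powr_add [symmetric] add.commute)
    ultimately show ?thesis
      using that L by (simp add: powr_divide)
  qed
  have "((\<lambda>s. ?b ((1 / L) *\<^sub>R s + (- t / L))) has_integral (Beta q p /\<^sub>R (1 / L) ^ DIM(real)))
      (cbox ((0 - (- t / L)) /\<^sub>R (1 / L)) ((1 - (- t / L)) /\<^sub>R (1 / L)))"
    using has_integral_Beta_real[OF q p] L by (intro has_integral_affinity') auto
  moreover have "cbox ((0 - (- t / L)) /\<^sub>R (1 / L)) ((1 - (- t / L)) /\<^sub>R (1 / L)) = {t..x}"
    using L by (auto simp: field_simps L_def)
  ultimately have "((\<lambda>s. ?b ((1 / L) *\<^sub>R s + (- t / L))) has_integral (Beta q p * L)) {t..x}"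
    using L by (simp add: field_simps)
  then have "((\<lambda>s. (L powr (p + q - 2) / (Gamma p * Gamma q)) * ?b ((1 / L) *\<^sub>R s + (- t / L)))
      has_integral ((L powr (p + q - 2) / (Gamma p * Gamma q)) * (Beta q p * L))) {t..x}"
    by (rule has_integral_mult_right)
  moreover have "(L powr (p + q - 2) / (Gamma p * Gamma q)) * (Beta q p * L) = frac_kernel (p + q) L"
  proof -
    have "L powr (p + q - 1) = L powr (p + q - 2) * L"
      using L powr_add[of L "p + q - 2" 1] by simp
    moreover have "Gamma p > 0" "Gamma q > 0" using p q by (auto intro: Gamma_real_pos)
    ultimately show ?thesis
      using L by (simp add: frac_kernel_def Beta_def add.commute)
  qed
  ultimately have "((\<lambda>s. (L powr (p + q - 2) / (Gamma p * Gamma q)) * ?b ((1 / L) *\<^sub>R s + (- t / L)))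
      has_integral frac_kernel (p + q) L) {t..x}"
    by simp
  then have "(?k has_integral frac_kernel (p + q) L) {t..x}"
  proof (rule has_integral_spike[rotated 2])
    show "negligible {t, x}" by simp
    show "?k s = (L powr (p + q - 2) / (Gamma p * Gamma q)) * ?b ((1 / L) *\<^sub>R s + (- t / L))"
      if "s \<in> {t..x} - {t, x}" for s
    proof -
      have "s \<in> {t..x}" "t < s" "s < x" using that by auto
      then show ?thesis
        using L by (subst eq) (auto simp: frac_kernel_def)
    qed
  qed
  then have "(?k has_integral frac_kernel (p + q) L) UNIV"
    by (rule has_integral_on_superset) (auto simp: frac_kernel_def)
  then have "(\<integral>\<^sup>+s. ?k s \<partial>lborel) = frac_kernel (p + q) L"
    using p q by (intro nn_integral_has_integral_lborel) (auto intro!: mult_nonneg_nonneg frac_kernel_nonneg)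
  then show ?thesis
    using p q unfolding L_def
    by (intro has_bochner_integral_nn_integral) (auto intro!: mult_nonneg_nonneg frac_kernel_nonneg AE_I2)
qed

lemmas integrable_frac_kernel_mult =
  has_bochner_integral_frac_kernel_mult[THEN integrable.intros]
lemmas integral_frac_kernel_mult =
  has_bochner_integral_frac_kernel_mult[THEN has_bochner_integral_integral_eq]

text \<open>Integrating the absolute value over s first leaves the kernel of order p + q against
  |G|, so \<open>int\<close> alone justifies Fubini. Its almost-everywhere part yields the inner
  integrals for s < x, where the factor \<open>frac_kernel p (x - s)\<close> is nonzero and can be
  cancelled.\<close>

lemma
  fixes G :: "real \<Rightarrow> real"
  assumes p: "0 < p" and q: "0 < q" and G [measurable]: "G \<in> borel_measurable borel"
    and int: "integrable lborel (\<lambda>t. frac_kernel (p + q) (x - t) * G t)"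
  shows integrable_frac_conv_conv:
      "integrable lborel (\<lambda>s. frac_kernel p (x - s) * (LINT t|lborel. frac_kernel q (s - t) * G t))"
    and frac_conv_conv:
      "(LINT s|lborel. frac_kernel p (x - s) * (LINT t|lborel. frac_kernel q (s - t) * G t))
        = (LINT t|lborel. frac_kernel (p + q) (x - t) * G t)"
    and AE_integrable_frac_conv:
      "AE s in lborel. s < x \<longrightarrow> integrable lborel (\<lambda>t. frac_kernel q (s - t) * G t)"
proof -
  let ?f = "\<lambda>t s. frac_kernel p (x - s) * (frac_kernel q (s - t) * G t)"
  have norm: "norm (?f t s) = frac_kernel p (x - s) * frac_kernel q (s - t) * \<bar>G t\<bar>" for t s
    using p q by (simp add: abs_mult frac_kernel_nonneg)
  have f: "integrable (lborel \<Otimes>\<^sub>M lborel) (case_prod ?f)"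
  proof (rule lborel_pair.Fubini_integrable)
    show "case_prod ?f \<in> borel_measurable (lborel \<Otimes>\<^sub>M lborel)" by measurable
    have "(\<lambda>t. LINT s|lborel. norm (case_prod ?f (t, s))) = (\<lambda>t. norm (frac_kernel (p + q) (x - t) * G t))"
      using p q by (simp only: case_prod_conv norm integral_mult_left_zero integral_frac_kernel_mult)
        (simp add: abs_mult frac_kernel_nonneg)
    then show "integrable lborel (\<lambda>t. LINT s|lborel. norm (case_prod ?f (t, s)))"
      using int by simp
    have "integrable lborel (\<lambda>s. frac_kernel p (x - s) * frac_kernel q (s - t) * G t)" for t
      by (intro integrable_mult_left integrable_frac_kernel_mult p q)
    then show "AE t in lborel. integrable lborel (\<lambda>s. case_prod ?f (t, s))"
      by (simp add: mult.assoc)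
  qed
  show "integrable lborel (\<lambda>s. frac_kernel p (x - s) * (LINT t|lborel. frac_kernel q (s - t) * G t))"
    using lborel_pair.integrable_snd[OF f] by simp
  have "(LINT s|lborel. ?f t s) = frac_kernel (p + q) (x - t) * G t" for t
    using integral_frac_kernel_mult[OF p q, of x t] by (simp flip: mult.assoc)
  then show "(LINT s|lborel. frac_kernel p (x - s) * (LINT t|lborel. frac_kernel q (s - t) * G t))
        = (LINT t|lborel. frac_kernel (p + q) (x - t) * G t)"
    using lborel_pair.Fubini_integral[OF f] by simp
  show "AE s in lborel. s < x \<longrightarrow> integrable lborel (\<lambda>t. frac_kernel q (s - t) * G t)"
    using lborel_pair.AE_integrable_snd[OF f]
  proof eventually_elim
    case (elim s)
    show ?case
    proof
      assume "s < x"
      moreover have "Gamma p \<noteq> 0"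
        using Gamma_real_pos[OF p] by linarith
      ultimately have "frac_kernel p (x - s) \<noteq> 0"
        by (simp add: frac_kernel_def)
      with elim show "integrable lborel (\<lambda>t. frac_kernel q (s - t) * G t)"
        by simp
    qed
  qed
qed

text \<open>Integrability in \<open>L1\<close> refers to the completed measure, whereas Fubini needs Borel functions.\<close>
definition borel_rep :: "real \<Rightarrow> real \<Rightarrow> (real \<Rightarrow> real) \<Rightarrow> (real \<Rightarrow> real) \<Rightarrow> bool" where
  "borel_rep a b g G \<longleftrightarrow> G \<in> borel_measurable borel \<and> (\<forall>t. t \<notin> {a..b} \<longrightarrow> G t = 0)
     \<and> (AE t in lborel. t \<in> {a..b} \<longrightarrow> g t = G t)"

text \<open>Bridges almost-everywhere statements, as Fubini and Borel representatives give them, to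
  the negligible sets in the spike rules of the gauge integral.\<close>

lemma AE_lborel_negligible:
  assumes "AE t in lborel. P t"
  obtains N where "negligible N" "\<And>t. t \<notin> N \<Longrightarrow> P t"
proof -
  obtain N where N: "{t \<in> space lborel. \<not> P t} \<subseteq> N" "N \<in> null_sets lborel"
    using assms by (auto elim!: AE_E3 AE_E simp: null_sets_def)
  then have "negligible N"
    by (simp add: negligible_iff_null_sets null_sets_completionI)
  with N that show thesis by auto
qed

lemma L1_borel_rep:
  assumes "g \<in> L1 a b"
  obtains G where "borel_rep a b g G" "integrable lborel G"
proof -
  let ?g = "\<lambda>t. indicator {a..b} t *\<^sub>R g t"
  have g: "integrable lebesgue ?g"
    using assms by (simp add: L1_def set_integrable_def)
  then obtain G0 where [measurable]: "G0 \<in> borel_measurable lborel" and G0: "AE t in lborel. ?g t = G0 t"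
    using completion_ex_borel_measurable_real[of ?g lborel] by auto
  \<comment> \<open>The Borel version agrees with the cut-off integrand only almost everywhere, so
    it is cut off again to vanish everywhere outside \<open>{a..b}\<close>.\<close>
  define G where "G t = indicator {a..b} t * G0 t" for t
  have [measurable]: "G \<in> borel_measurable lborel" unfolding G_def by measurable
  have eq: "AE t in lborel. ?g t = G t"
    using G0 by eventually_elim (auto simp: G_def split: split_indicator)
  then have "AE t in lebesgue. ?g t = G t" by (rule AE_completion)
  then have "integrable lebesgue G"
    using g by (subst integrable_cong_AE[symmetric]) (auto intro: borel_measurable_integrable measurable_completion)
  then have "integrable lborel G"
    by (simp add: integrable_completion)
  moreover have "borel_rep a b g G"
    unfolding borel_rep_def using eq by (auto simp: G_def indicator_def)
  ultimately show thesis using that by blast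
qed

text \<open>Links the gauge integral over \<open>{a..x}\<close> with the convolution over the line.
  \<open>b'\<close> is kept apart from \<open>b\<close> so that a representative on a shorter
  interval such as \<open>{a..x}\<close> also serves \<open>RL_L1 a b\<close>.\<close>

lemma
  assumes rep: "borel_rep a b g G" and x: "a \<le> x" "x \<le> b" and p: "0 < p"
    and int: "integrable lborel (\<lambda>t. frac_kernel p (x - t) * G t)"
  shows integrable_RL_L1: "(\<lambda>t. (x - t) powr (p - 1) * g t) integrable_on {a..x}"
    and RL_L1_eq_LINT: "RL_L1 a b' p g x = (LINT t|lborel. frac_kernel p (x - t) * G t)"
proof -
  let ?I = "LINT t|lborel. frac_kernel p (x - t) * G t"
  have Gp: "Gamma p > 0" using p by (rule Gamma_real_pos)
  obtain N where N: "negligible N" "\<And>t. t \<notin> N \<Longrightarrow> t \<in> {a..b} \<Longrightarrow> g t = G t"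
    using rep AE_lborel_negligible[of "\<lambda>t. t \<in> {a..b} \<longrightarrow> g t = G t"] unfolding borel_rep_def by blast
  have "((\<lambda>t. frac_kernel p (x - t) * G t) has_integral ?I) UNIV"
    by (rule has_integral_integral_real[OF int])
  moreover have "(\<lambda>t. frac_kernel p (x - t) * G t) = (\<lambda>t. if t \<in> {a..x} then frac_kernel p (x - t) * G t else 0)"
    using rep x by (auto simp: fun_eq_iff borel_rep_def frac_kernel_def)
  ultimately have "((\<lambda>t. frac_kernel p (x - t) * G t) has_integral ?I) {a..x}"
    using has_integral_restrict_UNIV by metis
  then have "((\<lambda>t. Gamma p * (frac_kernel p (x - t) * G t)) has_integral (Gamma p * ?I)) {a..x}"
    by (rule has_integral_mult_right)
  then have *: "((\<lambda>t. (x - t) powr (p - 1) * g t) has_integral (Gamma p * ?I)) {a..x}"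
    by (rule has_integral_spike[rotated 2, where S = "insert x N"])
      (use N Gp x in \<open>auto simp: frac_kernel_def\<close>)
  then show "(\<lambda>t. (x - t) powr (p - 1) * g t) integrable_on {a..x}"
    by blast
  show "RL_L1 a b' p g x = ?I"
    unfolding RL_L1_def using integral_unique[OF *] Gp by simp
qed

text \<open>For p >= 1 the kernel increases, so on \<open>{a..b}\<close> it is dominated by its
  value at b - a. This is the source of identities for L1 functions at every point rather than
  almost every point.\<close>

lemma integrable_frac_conv_L1:
  assumes p: "1 \<le> p" and rep: "borel_rep a b g G" and G: "integrable lborel G" and x: "x \<le> b"
  shows "integrable lborel (\<lambda>t. frac_kernel p (x - t) * G t)"
proof (rule Bochner_Integration.integrable_bound)
  show "integrable lborel (\<lambda>t. frac_kernel p (b - a) * G t)"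
    by (intro integrable_mult_right G)
  have [measurable]: "G \<in> borel_measurable borel" using rep by (simp add: borel_rep_def)
  show "(\<lambda>t. frac_kernel p (x - t) * G t) \<in> borel_measurable lborel" by measurable
  have "norm (frac_kernel p (x - t) * G t) \<le> norm (frac_kernel p (b - a) * G t)" for t
  proof (cases "t \<in> {a..b}")
    case True
    then have "frac_kernel p (x - t) \<le> frac_kernel p (b - a)"
      using p x by (intro frac_kernel_mono) auto
    then show ?thesis
      using p by (simp add: abs_mult frac_kernel_nonneg mult_right_mono)
  qed (use rep in \<open>simp add: borel_rep_def\<close>)
  then show "AE t in lborel. norm (frac_kernel p (x - t) * G t) \<le> norm (frac_kernel p (b - a) * G t)"
    by simp
qed

lemma continuous_borel_rep:
  fixes F :: "real \<Rightarrow> real"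
  assumes "continuous_on {a..b} F"
  obtains G where "borel_rep a b F G" "\<And>t. t \<in> {a..b} \<Longrightarrow> G t = F t"
proof
  let ?G = "\<lambda>t. indicator {a..b} t *\<^sub>R F t"
  have "?G \<in> borel_measurable borel"
    using assms by (intro borel_measurable_continuous_on_indicator) auto
  then show "borel_rep a b F ?G"
    by (auto simp: borel_rep_def)
  show "?G t = F t" if "t \<in> {a..b}" for t using that by simp
qed

lemma continuous_on_real_bounded:
  fixes F :: "real \<Rightarrow> real"
  assumes "continuous_on {a..b} F"
  obtains M where "0 \<le> M" "\<And>t. t \<in> {a..b} \<Longrightarrow> \<bar>F t\<bar> \<le> M"
proof -
  have "bounded (F ` {a..b})"
    using assms by (intro compact_imp_bounded compact_continuous_image) auto
  then obtain M where "\<forall>t\<in>{a..b}. \<bar>F t\<bar> \<le> M"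
    unfolding bounded_iff by auto
  then show thesis
    using that[of "\<bar>M\<bar>"] by force
qed

text \<open>The kernel may be singular but is integrable. In the majorant,
  \<open>frac_kernel 1 (t - a)\<close> acts as the indicator of t > a, so its integral is an
  instance of the composition law, which explains the order p + 1 in the bound.\<close>

lemma
  fixes G :: "real \<Rightarrow> real"
  assumes p: "0 < p" and rep: "borel_rep a b g G" and M: "0 \<le> M" "\<And>t. t \<in> {a..b} \<Longrightarrow> \<bar>G t\<bar> \<le> M"
  shows integrable_frac_conv_bounded: "integrable lborel (\<lambda>t. frac_kernel p (x - t) * G t)"
    and abs_frac_conv_le: "\<bar>LINT t|lborel. frac_kernel p (x - t) * G t\<bar> \<le> M * frac_kernel (p + 1) (x - a)"
proof -
  let ?w = "\<lambda>t. M * (frac_kernel p (x - t) * frac_kernel 1 (t - a))"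
  have w: "integrable lborel ?w"
    by (intro integrable_mult_right integrable_frac_kernel_mult p zero_less_one)
  have [measurable]: "G \<in> borel_measurable borel" using rep by (simp add: borel_rep_def)
  have "AE t in lborel. t \<noteq> a" by (rule AE_lborel_singleton)
  then have bound: "AE t in lborel. norm (frac_kernel p (x - t) * G t) \<le> ?w t"
  proof eventually_elim
    case (elim t)
    show ?case
    proof (cases "t \<in> {a..b}")
      case True
      then have "frac_kernel p (x - t) * \<bar>G t\<bar> \<le> frac_kernel p (x - t) * M"
        using M p by (intro mult_left_mono frac_kernel_nonneg)
      with True elim p show ?thesis
        by (simp add: abs_mult frac_kernel_nonneg frac_kernel_1 mult.commute)
    next
      case False
      then have "G t = 0" using rep by (simp add: borel_rep_def)
      with M p show ?thesis
        by (simp add: frac_kernel_nonneg)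
    qed
  qed
  then have bound': "AE t in lborel. norm (frac_kernel p (x - t) * G t) \<le> norm (?w t)"
    by eventually_elim (metis abs_ge_self order_trans real_norm_def)
  show int: "integrable lborel (\<lambda>t. frac_kernel p (x - t) * G t)"
    by (rule Bochner_Integration.integrable_bound[OF w _ bound']) measurable
  have "\<bar>LINT t|lborel. frac_kernel p (x - t) * G t\<bar> \<le> (LINT t|lborel. norm (frac_kernel p (x - t) * G t))"
    using integral_norm_bound[of lborel "\<lambda>t. frac_kernel p (x - t) * G t"] by simp
  also have "\<dots> \<le> (LINT t|lborel. ?w t)"
    using bound by (intro integral_mono_AE integrable_norm int w)
  also have "\<dots> = M * frac_kernel (p + 1) (x - a)"
    using integral_frac_kernel_mult[OF p zero_less_one, of x a] by simp
  finally show "\<bar>LINT t|lborel. frac_kernel p (x - t) * G t\<bar> \<le> M * frac_kernel (p + 1) (x - a)" .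
qed

lemma frac_conv_eq_0:
  assumes "borel_rep a b g G" "s \<le> a"
  shows "(LINT t|lborel. frac_kernel q (s - t) * G t) = 0"
proof -
  have "frac_kernel q (s - t) * G t = 0" for t
    using assms by (cases "t < s") (auto simp: borel_rep_def frac_kernel_def)
  then show ?thesis by (simp only: Bochner_Integration.integral_zero)
qed

section \<open>Composition, bounds and continuity of fractional integrals of functions\<close>

lemma AE_RL_L1_eq_LINT:
  fixes G :: "real \<Rightarrow> real"
  assumes p: "0 < p" and q: "0 < q" and rep: "borel_rep a b g G" and x: "x \<le> b"
    and int: "integrable lborel (\<lambda>t. frac_kernel (p + q) (x - t) * G t)"
  shows "AE s in lborel. s \<in> {a..x} \<longrightarrow> RL_L1 a b' q g s = (LINT t|lborel. frac_kernel q (s - t) * G t)"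
proof -
  have "G \<in> borel_measurable borel" using rep by (simp add: borel_rep_def)
  from AE_integrable_frac_conv[OF p q this int]
  have *: "AE s in lborel. s < x \<longrightarrow> integrable lborel (\<lambda>t. frac_kernel q (s - t) * G t)" .
  have "AE s in lborel. s \<noteq> x" by (rule AE_lborel_singleton)
  with * show ?thesis
  proof eventually_elim
    case (elim s)
    show ?case
    proof
      assume "s \<in> {a..x}"
      with elim x show "RL_L1 a b' q g s = (LINT t|lborel. frac_kernel q (s - t) * G t)"
        by (intro RL_L1_eq_LINT[OF rep _ _ q]) auto
    qed
  qed
qed

text \<open>The inner operator is known to equal the Borel convolution \<open>H\<close> only off a
  null set, which the outer integral does not see. So \<open>H\<close>, cut off to
  \<open>{a..x}\<close>, serves as its representative, and Fubini does the rest.\<close>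

lemma RL_L1_RL_L1:
  fixes G :: "real \<Rightarrow> real"
  assumes p: "0 < p" and q: "0 < q" and rep: "borel_rep a b g G" and x: "a \<le> x" "x \<le> b"
    and int: "integrable lborel (\<lambda>t. frac_kernel (p + q) (x - t) * G t)"
  shows "RL_L1 a b p (RL_L1 a b q g) x = RL_L1 a b (p + q) g x"
proof -
  have G [measurable]: "G \<in> borel_measurable borel" using rep by (simp add: borel_rep_def)
  define H where "H s = (LINT t|lborel. frac_kernel q (s - t) * G t)" for s
  define H' where "H' s = indicator {a..x} s * H s" for s
  have [measurable]: "H \<in> borel_measurable borel" unfolding H_def by measurable
  have rep': "borel_rep a x (RL_L1 a b q g) H'"
    unfolding borel_rep_def
  proof (intro conjI)
    show "H' \<in> borel_measurable borel" unfolding H'_def by measurable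
    show "\<forall>t. t \<notin> {a..x} \<longrightarrow> H' t = 0" by (simp add: H'_def)
    show "AE t in lborel. t \<in> {a..x} \<longrightarrow> RL_L1 a b q g t = H' t"
      using AE_RL_L1_eq_LINT[OF p q rep x(2) int, of b]
      by eventually_elim (auto simp: H'_def H_def)
  qed
  \<comment> \<open>The cut-off is harmless: the kernel vanishes for s >= x and \<open>H\<close>
    vanishes for s <= a.\<close>
  have eq: "frac_kernel p (x - s) * H' s = frac_kernel p (x - s) * H s" for s
    using frac_conv_eq_0[OF rep, of s q]
    by (cases "s \<in> {a..x}") (auto simp: H'_def H_def frac_kernel_def)
  have "RL_L1 a b p (RL_L1 a b q g) x = (LINT s|lborel. frac_kernel p (x - s) * H' s)"
    using integrable_frac_conv_conv[OF p q G int] x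
    by (intro RL_L1_eq_LINT[OF rep' _ _ p]) (simp_all add: eq H_def)
  also have "\<dots> = (LINT t|lborel. frac_kernel (p + q) (x - t) * G t)"
    unfolding eq unfolding H_def by (rule frac_conv_conv[OF p q G int])
  also have "\<dots> = RL_L1 a b (p + q) g x"
    using p q x by (intro RL_L1_eq_LINT[OF rep _ _ _ int, symmetric]) auto
  finally show ?thesis .
qed

text \<open>Compose with order 1 at the point b: \<open>frac_kernel 1 (b - s)\<close> is the
  indicator of s < b, and the total order 1 + q exceeds 1, so integrability of the composite is
  integrability of the inner convolution on \<open>{a..b}\<close>.\<close>

lemma RL_L1_in_L1:
  assumes q: "0 < q" and g: "g \<in> L1 a b"
  shows "RL_L1 a b q g \<in> L1 a b"
proof -
  obtain G where rep: "borel_rep a b g G" and G: "integrable lborel G"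
    using L1_borel_rep[OF g] by metis
  have [measurable]: "G \<in> borel_measurable borel" using rep by (simp add: borel_rep_def)
  define H where "H s = (LINT t|lborel. frac_kernel q (s - t) * G t)" for s
  have [measurable]: "H \<in> borel_measurable borel" unfolding H_def by measurable
  have int: "integrable lborel (\<lambda>t. frac_kernel (1 + q) (b - t) * G t)"
    using q by (intro integrable_frac_conv_L1[OF _ rep G]) auto
  have "integrable lborel (\<lambda>s. frac_kernel 1 (b - s) * H s)"
    unfolding H_def by (intro integrable_frac_conv_conv q int) (auto simp: rep)
  then have "integrable lebesgue (\<lambda>s. frac_kernel 1 (b - s) * H s)"
    by (simp add: integrable_completion)
  then have "(\<lambda>s. frac_kernel 1 (b - s) * H s) absolutely_integrable_on UNIV"
    by (simp add: set_integrable_def)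
  then have abs: "(\<lambda>s. frac_kernel 1 (b - s) * H s) absolutely_integrable_on {a..b}"
    by (rule set_integrable_subset) auto
  obtain N where N: "negligible N"
    "\<And>s. s \<notin> N \<Longrightarrow> s \<in> {a..b} \<Longrightarrow> RL_L1 a b q g s = (LINT t|lborel. frac_kernel q (s - t) * G t)"
    using AE_lborel_negligible[OF AE_RL_L1_eq_LINT[OF zero_less_one q rep order.refl int, of b]] by blast
  have "RL_L1 a b q g absolutely_integrable_on {a..b}"
    by (rule absolutely_integrable_spike[OF abs, of "insert b N"])
      (use N in \<open>auto simp: H_def frac_kernel_1\<close>)
  then show ?thesis by (simp add: L1_def)
qed

lemma borel_rep_bounded:
  assumes "continuous_on {a..b} F"
  obtains G M where "borel_rep a b F G" "\<And>t. t \<in> {a..b} \<Longrightarrow> G t = F t" "0 \<le> M" "\<And>t. t \<in> {a..b} \<Longrightarrow> \<bar>G t\<bar> \<le> M"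
  using continuous_borel_rep[OF assms] continuous_on_real_bounded[OF assms] by metis

lemma RL_L1_RL_L1_continuous:
  assumes "0 < p" "0 < q" "continuous_on {a..b} F" "x \<in> {a..b}"
  shows "RL_L1 a b p (RL_L1 a b q F) x = RL_L1 a b (p + q) F x"
proof -
  obtain G M where G: "borel_rep a b F G" "0 \<le> M" "\<And>t. t \<in> {a..b} \<Longrightarrow> \<bar>G t\<bar> \<le> M"
    using borel_rep_bounded[OF assms(3)] by metis
  show ?thesis
    using assms by (intro RL_L1_RL_L1[OF _ _ G(1)] integrable_frac_conv_bounded[OF _ G]) auto
qed

lemma RL_L1_RL_L1_L1:
  assumes "0 < p" "0 < q" "1 \<le> p + q" "g \<in> L1 a b" "x \<in> {a..b}"
  shows "RL_L1 a b p (RL_L1 a b q g) x = RL_L1 a b (p + q) g x"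
proof -
  obtain G where G: "borel_rep a b g G" "integrable lborel G"
    using L1_borel_rep[OF assms(4)] by metis
  show ?thesis
    using assms by (intro RL_L1_RL_L1[OF _ _ G(1)] integrable_frac_conv_L1[OF _ G]) auto
qed

text \<open>The constant is (b - a)^p / Gamma (p + 1), the value at b of the fractional integral of
  the function 1.\<close>

lemma abs_RL_L1_le:
  assumes p: "0 < p" and F: "continuous_on {a..b} F" and M: "0 \<le> M" "\<And>t. t \<in> {a..b} \<Longrightarrow> \<bar>F t\<bar> \<le> M"
    and x: "x \<in> {a..b}"
  shows "\<bar>RL_L1 a b p F x\<bar> \<le> M * frac_kernel (p + 1) (b - a)"
proof -
  obtain G where G: "borel_rep a b F G" "\<And>t. t \<in> {a..b} \<Longrightarrow> G t = F t"
    using continuous_borel_rep[OF F] by metis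
  have GM: "\<And>t. t \<in> {a..b} \<Longrightarrow> \<bar>G t\<bar> \<le> M" using G M by simp
  have "RL_L1 a b p F x = (LINT t|lborel. frac_kernel p (x - t) * G t)"
    using x p by (intro RL_L1_eq_LINT[OF G(1)] integrable_frac_conv_bounded[OF p G(1) M(1) GM]) auto
  also have "\<bar>\<dots>\<bar> \<le> M * frac_kernel (p + 1) (x - a)"
    by (rule abs_frac_conv_le[OF p G(1) M(1) GM])
  also have "\<dots> \<le> M * frac_kernel (p + 1) (b - a)"
    using x p M by (intro mult_left_mono frac_kernel_mono) auto
  finally show ?thesis .
qed

lemma RL_L1_integrable_continuous:
  assumes p: "0 < p" and F: "continuous_on {a..b} F" and x: "(x :: real) \<in> {a..b}"
  shows "(\<lambda>t. (x - t) powr (p - 1) * F t) integrable_on {a..x}"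
proof -
  obtain G M where G: "borel_rep a b F G" "0 \<le> M" "\<And>t. t \<in> {a..b} \<Longrightarrow> \<bar>G t\<bar> \<le> M"
    using borel_rep_bounded[OF F] by metis
  show ?thesis
    using x p by (intro integrable_RL_L1[OF G(1) _ _ p] integrable_frac_conv_bounded[OF p G]) auto
qed

lemma RL_L1_diff:
  assumes p: "0 < p" and F: "continuous_on {a..b} F" and G: "continuous_on {a..b} G" and x: "x \<in> {a..b}"
  shows "RL_L1 a b p (\<lambda>t. F t - G t) x = RL_L1 a b p F x - RL_L1 a b p G x"
  unfolding RL_L1_def right_diff_distrib
  by (subst Henstock_Kurzweil_Integration.integral_diff)
    (auto intro!: RL_L1_integrable_continuous assms simp: right_diff_distrib)

text \<open>The substitution s = x - t moves x out of the singular kernel into the continuous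
  function, after which dominated convergence applies.\<close>

lemma RL_L1_in_C0:
  assumes p: "0 < p" and F: "F \<in> C0 a b"
  shows "RL_L1 a b p F \<in> C0 a b"
proof -
  have cF: "continuous_on {a..b} F" and Fa: "F a = 0" using F by (auto simp: C0_def)
  \<comment> \<open>Clamping the argument extends \<open>F\<close> continuously to the line. Since F
    a = 0 the extension vanishes left of \<open>a\<close>; values right of \<open>b\<close> meet a
    zero kernel when x <= b.\<close>
  define E where "E t = F (max a (min b t))" for t
  obtain G where G: "borel_rep a b F G" "\<And>t. t \<in> {a..b} \<Longrightarrow> G t = F t"
    using continuous_borel_rep[OF cF] by metis
  obtain M where M: "0 \<le> M" "\<And>t. t \<in> {a..b} \<Longrightarrow> \<bar>F t\<bar> \<le> M"
    using continuous_on_real_bounded[OF cF] by metis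
  show ?thesis
  proof (cases "a \<le> b")
    case False
    then show ?thesis by (simp add: C0_def RL_L1_def)
  next
    case ab: True
    have E: "continuous_on UNIV E"
      unfolding E_def using ab
      by (intro continuous_on_compose2[OF cF] continuous_intros) auto
    then have [measurable]: "E \<in> borel_measurable borel"
      by (rule borel_measurable_continuous_onI)
    have EM: "\<bar>E t\<bar> \<le> M" for t
      unfolding E_def using ab by (intro M) auto
    \<comment> \<open>For s >= b - a the point x - s is at most \<open>a\<close> for every x in
      \<open>{a..b}\<close>, where \<open>E\<close> is 0. Hence one majorant supported on 0 < s < b
      - a works for all x.\<close>
    let ?w = "\<lambda>s. M * (frac_kernel 1 ((b - a) - s) * frac_kernel p (s - 0))"
    have eq: "RL_L1 a b p F x = (LINT s|lborel. frac_kernel p s * E (x - s))" if "x \<in> {a..b}" for x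
    proof -
      have "RL_L1 a b p F x = (LINT t|lborel. frac_kernel p (x - t) * G t)"
        using that p G M
        by (intro RL_L1_eq_LINT[OF G(1)] integrable_frac_conv_bounded[OF p G(1) M(1)]) auto
      also have "\<dots> = (LINT t|lborel. frac_kernel p (x - t) * E t)"
      proof (rule Bochner_Integration.integral_cong)
        fix t
        show "frac_kernel p (x - t) * G t = frac_kernel p (x - t) * E t"
          using that G Fa ab
          by (cases "t \<in> {a..b}"; cases "t < x") (auto simp: frac_kernel_def E_def borel_rep_def max_def min_def)
      qed simp
      also have "\<dots> = (LINT s|lborel. frac_kernel p (x - (x + (-1) * s)) * E (x + (-1) * s))"
        using lborel_integral_real_affine[of "-1" "\<lambda>t. frac_kernel p (x - t) * E t" x] by simp
      finally show ?thesis by simp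
    qed
    have "continuous_on {a..b} (\<lambda>x. LINT s|lborel. frac_kernel p s * E (x - s))"
      unfolding continuous_on_sequentially
    proof (intro allI ballI impI)
      fix X x assume x: "x \<in> {a..b}" and X: "(\<forall>n. X n \<in> {a..b}) \<and> X \<longlonglongrightarrow> x"
      have "(\<lambda>n. LINT s|lborel. frac_kernel p s * E (X n - s)) \<longlonglongrightarrow> (LINT s|lborel. frac_kernel p s * E (x - s))"
      proof (rule integral_dominated_convergence[where w = ?w])
        show "integrable lborel ?w"
          by (intro integrable_mult_right integrable_frac_kernel_mult p zero_less_one)
        have "isCont E (x - s)" for s
          using E by (simp add: continuous_on_eq_continuous_at)
        then have "(\<lambda>n. E (X n - s)) \<longlonglongrightarrow> E (x - s)" for s
          using X by (intro isCont_tendsto_compose[of _ E] tendsto_intros) auto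
        then show "AE s in lborel. (\<lambda>n. frac_kernel p s * E (X n - s)) \<longlonglongrightarrow> frac_kernel p s * E (x - s)"
          by (intro AE_I2 tendsto_mult tendsto_const)
        have "AE s in lborel. s \<noteq> b - a" by (rule AE_lborel_singleton)
        then show "AE s in lborel. norm (frac_kernel p s * E (X n - s)) \<le> ?w s" for n
        proof eventually_elim
          case (elim s)
          show ?case
          proof (cases "s < b - a")
            case True
            then show ?thesis
              using EM[of "X n - s"] p
              by (simp add: frac_kernel_1 abs_mult frac_kernel_nonneg mult.commute[of M] mult_left_mono)
          next
            case False
            have "X n \<le> b" using X by auto
            with elim False have "E (X n - s) = 0" using Fa ab by (simp add: E_def max_def)
            then show ?thesis using p M by (simp add: frac_kernel_nonneg)
          qed
        qed
      qed measurable
      then show "((\<lambda>x. LINT s|lborel. frac_kernel p s * E (x - s)) \<circ> X) \<longlonglongrightarrow> (LINT s|lborel. frac_kernel p s * E (x - s))"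
        by (simp add: o_def)
    qed
    then have "continuous_on {a..b} (RL_L1 a b p F)"
      by (rule continuous_on_eq) (simp add: eq)
    then show ?thesis by (simp add: C0_def RL_L1_def)
  qed
qed

section \<open>Embedding of integrable functions\<close>

lemma test_fn_deriv_continuous:
  assumes "test_fn a b \<phi>"
  shows "continuous_on A (deriv \<phi>)"
proof -
  have "((deriv ^^ 1) \<phi>) differentiable (at t)" for t
    using assms unfolding test_fn_def by blast
  then show ?thesis
    by (intro continuous_at_imp_continuous_on ballI differentiable_imp_continuous_within) simp
qed

lemma test_fn_has_derivative:
  assumes "test_fn a b \<phi>"
  shows "(\<phi> has_real_derivative deriv \<phi> t) (at t)"
proof -
  have "((deriv ^^ 0) \<phi>) differentiable (at t)"
    using assms unfolding test_fn_def by blast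
  then show ?thesis
    by (simp add: DERIV_deriv_iff_real_differentiable)
qed

lemma RL_L1_1:
  assumes x: "a \<le> x"
  shows "RL_L1 a b 1 g x = integral {a..x} g"
proof -
  \<comment> \<open>The integrands may differ at t = x, since \<open>0 powr 0\<close> is 0.\<close>
  have "integral {a..x} (\<lambda>t. (x - t) powr (1 - 1) * g t) = integral {a..x} g"
    by (rule integral_spike[of "{x}"]) auto
  then show ?thesis by (simp add: RL_L1_def)
qed

lemma RL_L1_1_in_C0:
  assumes g: "g \<in> L1 a b"
  shows "RL_L1 a b 1 g \<in> C0 a b"
proof -
  have "g integrable_on {a..b}"
    using g set_lebesgue_integral_eq_integral(1) by (auto simp: L1_def)
  then have "continuous_on {a..b} (\<lambda>x. integral {a..x} g)"
    by (rule indefinite_integral_continuous_1)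
  then have "continuous_on {a..b} (RL_L1 a b 1 g)"
    by (rule continuous_on_eq) (simp add: RL_L1_1)
  then show ?thesis
    by (simp add: C0_def RL_L1_def)
qed

text \<open>Integration by parts for a merely integrable \<open>g\<close>, obtained from Fubini on
  the triangle t < s, whose indicator is \<open>frac_kernel 1 (s - t)\<close>. Integrating \<phi>'
  over s leaves -\<phi>(t), because \<phi>(b) = 0; integrating \<open>g\<close> over t leaves its
  indefinite integral at s.\<close>

lemma embed_eq_distD:
  assumes ab: "a < b" and g: "g \<in> L1 a b"
  shows "embed a b g = distD a b (RL_L1 a b 1 g)"
proof (rule ext)
  fix \<phi>
  show "embed a b g \<phi> = distD a b (RL_L1 a b 1 g) \<phi>"
  proof (cases "test_fn a b \<phi>")
    case False
    then show ?thesis by (simp add: embed_def distD_def)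
  next
    case tf: True
    obtain G where rep: "borel_rep a b g G" and G: "integrable lborel G"
      using L1_borel_rep[OF g] by metis
    have [measurable]: "G \<in> borel_measurable borel" using rep by (simp add: borel_rep_def)
    define \<psi> where "\<psi> s = indicator {a..b} s *\<^sub>R deriv \<phi> s" for s
    have \<psi>: "integrable lborel \<psi>"
      unfolding \<psi>_def using borel_integrable_atLeastAtMost'[OF test_fn_deriv_continuous[OF tf]]
      by (simp add: set_integrable_def)
    then have [measurable]: "\<psi> \<in> borel_measurable borel" by auto
    let ?f = "\<lambda>t s. G t * (frac_kernel 1 (s - t) * \<psi> s)"
    have int_k: "integrable lborel (\<lambda>s. frac_kernel 1 (s - t) * \<psi> s)" for t
      by (rule Bochner_Integration.integrable_bound[OF \<psi>]) (auto simp: frac_kernel_1)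
    have f: "integrable (lborel \<Otimes>\<^sub>M lborel) (case_prod ?f)"
    proof (rule lborel_pair.Fubini_integrable)
      show "case_prod ?f \<in> borel_measurable (lborel \<Otimes>\<^sub>M lborel)" by measurable
      show "AE t in lborel. integrable lborel (\<lambda>s. case_prod ?f (t, s))"
        using int_k by (auto intro!: AE_I2)
      let ?C = "LINT s|lborel. \<bar>\<psi> s\<bar>"
      show "integrable lborel (\<lambda>t. LINT s|lborel. norm (case_prod ?f (t, s)))"
      proof (rule Bochner_Integration.integrable_bound)
        show "integrable lborel (\<lambda>t. ?C * G t)" using G by simp
        show "AE t in lborel. norm (LINT s|lborel. norm (case_prod ?f (t, s))) \<le> norm (?C * G t)"
        proof (rule AE_I2)
          fix t
          have "(LINT s|lborel. \<bar>frac_kernel 1 (s - t) * \<psi> s\<bar>) \<le> ?C"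
            using int_k \<psi> by (intro integral_mono) (auto simp: frac_kernel_1)
          moreover have "0 \<le> (LINT s|lborel. \<bar>frac_kernel 1 (s - t) * \<psi> s\<bar>)" by simp
          ultimately show "norm (LINT s|lborel. norm (case_prod ?f (t, s))) \<le> norm (?C * G t)"
            by (simp add: abs_mult mult.commute[of ?C] mult_left_mono)
        qed
      qed measurable
    qed
    obtain N where N: "negligible N" "\<And>t. t \<notin> N \<Longrightarrow> t \<in> {a..b} \<Longrightarrow> g t = G t"
      using rep AE_lborel_negligible[of "\<lambda>t. t \<in> {a..b} \<longrightarrow> g t = G t"] unfolding borel_rep_def by blast
    have "(LINT s|lborel. frac_kernel 1 (s - t) * \<psi> s) = - \<phi> t" if t: "t \<in> {a..b}" for t
    proof -
      have "\<phi> b = 0" using tf by (force simp: test_fn_def)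
      have "(deriv \<phi> has_integral (\<phi> b - \<phi> t)) {t..b}"
        using t by (intro fundamental_theorem_of_calculus)
          (auto intro!: has_field_derivative_at_within[OF test_fn_has_derivative[OF tf]] simp flip: has_real_derivative_iff_has_vector_derivative)
      then have "((\<lambda>s. frac_kernel 1 (s - t) * \<psi> s) has_integral (\<phi> b - \<phi> t)) {t..b}"
        by (rule has_integral_spike[rotated 2, where S = "{t}"])
          (use t in \<open>auto simp: frac_kernel_1 \<psi>_def\<close>)
      then have "((\<lambda>s. frac_kernel 1 (s - t) * \<psi> s) has_integral (\<phi> b - \<phi> t)) UNIV"
        by (rule has_integral_on_superset) (auto simp: frac_kernel_1 \<psi>_def)
      from has_integral_unique[OF has_integral_integral_real[OF int_k] this] \<open>\<phi> b = 0\<close>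
      show ?thesis by simp
    qed
    then have inner: "(LINT s|lborel. ?f t s) = - (G t * \<phi> t)" for t
      using rep by (cases "t \<in> {a..b}") (auto simp: borel_rep_def)
    have "((\<lambda>t. LINT s|lborel. ?f t s) has_integral (LINT t|lborel. LINT s|lborel. ?f t s)) UNIV"
      by (intro has_integral_integral_real lborel_pair.integrable_fst[OF f])
    then have "((\<lambda>t. - (G t * \<phi> t)) has_integral (LINT t|lborel. LINT s|lborel. ?f t s)) UNIV"
      unfolding inner .
    moreover have "(\<lambda>t. - (G t * \<phi> t)) = (\<lambda>t. if t \<in> {a..b} then - (G t * \<phi> t) else 0)"
      using rep by (auto simp: borel_rep_def)
    ultimately have "((\<lambda>t. if t \<in> {a..b} then - (G t * \<phi> t) else 0) has_integral (LINT t|lborel. LINT s|lborel. ?f t s)) UNIV"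
      by simp
    then have "((\<lambda>t. - (G t * \<phi> t)) has_integral (LINT t|lborel. LINT s|lborel. ?f t s)) {a..b}"
      by (simp only: has_integral_restrict_UNIV)
    from has_integral_neg[OF this]
    have "((\<lambda>t. g t * \<phi> t) has_integral - (LINT t|lborel. LINT s|lborel. ?f t s)) {a..b}"
      by (rule has_integral_spike[rotated 2, where S = N]) (use N in auto)
    then have L: "embed a b g \<phi> = - (LINT t|lborel. LINT s|lborel. ?f t s)"
      using tf by (simp add: embed_def integral_unique)
    have "((\<lambda>s. LINT t|lborel. ?f t s) has_integral (LINT s|lborel. LINT t|lborel. ?f t s)) UNIV"
      by (intro has_integral_integral_real lborel_pair.integrable_snd[OF f])
    moreover have "(LINT t|lborel. ?f t s) = (if s \<in> {a..b} then RL_L1 a b 1 g s * deriv \<phi> s else 0)" for s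
    proof (cases "s \<in> {a..b}")
      case True
      have "RL_L1 a b 1 g s = (LINT t|lborel. frac_kernel 1 (s - t) * G t)"
        using True by (intro RL_L1_eq_LINT[OF rep] integrable_frac_conv_L1[OF _ rep G]) auto
      moreover have "(LINT t|lborel. ?f t s) = (LINT t|lborel. frac_kernel 1 (s - t) * G t * \<psi> s)"
        by (simp only: ac_simps)
      ultimately show ?thesis using True by (simp add: \<psi>_def)
    qed (auto simp: \<psi>_def)
    ultimately have "((\<lambda>s. RL_L1 a b 1 g s * deriv \<phi> s) has_integral (LINT s|lborel. LINT t|lborel. ?f t s)) {a..b}"
      by (simp only: has_integral_restrict_UNIV)
    then have R: "distD a b (RL_L1 a b 1 g) \<phi> = - (LINT s|lborel. LINT t|lborel. ?f t s)"
      using tf by (simp add: distD_def integral_unique)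
    show ?thesis
      unfolding L R using lborel_pair.Fubini_integral[OF f] by simp
  qed
qed

lemma C0_in_L1: "F \<in> C0 a b \<Longrightarrow> F \<in> L1 a b"
  by (simp add: C0_def L1_def absolutely_integrable_continuous_real)

lemma distD_cong:
  assumes "\<And>x. x \<in> {a..b} \<Longrightarrow> F x = G x"
  shows "distD a b F = distD a b G"
  unfolding distD_def by (intro ext if_cong refl arg_cong[where f = uminus] integral_cong) (simp add: assms)

lemma RL_L1_cong:
  assumes "\<And>x. x \<in> {a..b} \<Longrightarrow> F x = G x" "x \<in> {a..b}"
  shows "RL_L1 a b p F x = RL_L1 a b p G x"
  unfolding RL_L1_def by (intro arg_cong2[where f = times] refl integral_cong) (use assms in auto)

lemma RL_fun_1:
  assumes "f \<in> DHK a b"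
  shows "RL_fun a b 1 f x = primitive a b f x"
proof -
  have "primitive a b f a = 0" using primitive_in_C0[OF assms] by (simp add: C0_def)
  then show ?thesis
    by (simp add: RL_fun_def dhk_int_mul_def RL_kernel_def[abs_def])
qed

text \<open>Both boundary terms of the integration by parts vanish: F a = 0 at the lower end and the
  kernel is 0 at t = x. Differentiating the kernel brings out -(n - 1), which Gamma n = (n - 1)
  Gamma (n - 1) absorbs.\<close>

lemma RL_fun_gt_1:
  assumes n: "1 < n" and f: "f \<in> DHK a b" and x: "x \<in> {a..b}"
  shows "RL_fun a b n f x = RL_L1 a b (n - 1) (primitive a b f) x"
proof -
  let ?F = "primitive a b f"
  have Fa: "?F a = 0" and cF: "continuous_on {a..b} ?F"
    using primitive_in_C0[OF f] by (auto simp: C0_def)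
  have "deriv (RL_kernel n x) t = - (n - 1) * (x - t) powr (n - 1 - 1)" if "t < x" for t
  proof (rule DERIV_imp_deriv)
    have "((\<lambda>t. (x - t) powr (n - 1)) has_real_derivative - (n - 1) * (x - t) powr (n - 1 - 1)) (at t)"
      using that DERIV_chain2[where f = "\<lambda>z. z powr (n - 1)" and g = "\<lambda>t. x - t", OF has_real_derivative_powr, where Db = "- 1"]
      by (auto intro!: derivative_eq_intros simp: algebra_simps)
    then show "(RL_kernel n x has_real_derivative - (n - 1) * (x - t) powr (n - 1 - 1)) (at t)"
      using n by (simp add: RL_kernel_def[abs_def])
  qed
  then have "integral {a..x} (\<lambda>t. ?F t * deriv (RL_kernel n x) t)
      = integral {a..x} (\<lambda>t. - (n - 1) * ((x - t) powr (n - 1 - 1) * ?F t))"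
    by (intro integral_spike[of "{x}"]) auto
  also have "\<dots> = - (n - 1) * integral {a..x} (\<lambda>t. (x - t) powr (n - 1 - 1) * ?F t)"
    by (rule integral_mult_right)
  finally have "RL_fun a b n f x = (n - 1) / Gamma n * integral {a..x} (\<lambda>t. (x - t) powr (n - 1 - 1) * ?F t)"
    using n Fa by (simp add: RL_fun_def dhk_int_mul_def RL_kernel_def minus_divide_left left_diff_distrib)
  moreover have "Gamma n = (n - 1) * Gamma (n - 1)"
    using Gamma_plus1[of "n - 1"] nonpos_Ints_nonpos[of "n - 1"] n by force
  ultimately show ?thesis
    using n by (simp add: RL_L1_def)
qed

section \<open>The fractional integral operators\<close>

lemma C0_diff: "F \<in> C0 a b \<Longrightarrow> G \<in> C0 a b \<Longrightarrow> (\<lambda>x. F x - G x) \<in> C0 a b"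
  by (auto simp: C0_def intro: continuous_intros)

lemma dminus_distD:
  assumes F: "F \<in> C0 a b" and G: "G \<in> C0 a b"
  shows "dminus (distD a b F) (distD a b G) = distD a b (\<lambda>x. F x - G x)"
proof
  fix \<phi>
  show "dminus (distD a b F) (distD a b G) \<phi> = distD a b (\<lambda>x. F x - G x) \<phi>"
  proof (cases "test_fn a b \<phi>")
    case True
    have "integral {a..b} (\<lambda>t. F t * deriv \<phi> t - G t * deriv \<phi> t)
        = integral {a..b} (\<lambda>t. F t * deriv \<phi> t) - integral {a..b} (\<lambda>t. G t * deriv \<phi> t)"
      using F G by (intro Henstock_Kurzweil_Integration.integral_diff integrable_continuous_interval
          continuous_intros test_fn_deriv_continuous[OF True]) (auto simp: C0_def)
    then show ?thesis
      using True by (simp add: dminus_def distD_def left_diff_distrib)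
  qed (simp add: dminus_def distD_def)
qed

lemma alex_norm_distD:
  assumes "a < b" "F \<in> C0 a b"
  shows "alex_norm a b (distD a b F) = (SUP x\<in>{a..b}. \<bar>F x\<bar>)"
  unfolding alex_norm_def by (intro SUP_cong refl) (simp add: primitive_distD assms)

lemma abs_le_alex_norm:
  assumes "a < b" "F \<in> C0 a b" "x \<in> {a..b}"
  shows "\<bar>F x\<bar> \<le> alex_norm a b (distD a b F)"
proof -
  obtain M where "\<And>t. t \<in> {a..b} \<Longrightarrow> \<bar>F t\<bar> \<le> M"
    using continuous_on_real_bounded[of a b F] assms by (auto simp: C0_def)
  then show ?thesis
    unfolding alex_norm_distD[OF assms(1,2)]
    using assms(3) by (intro cSUP_upper bdd_aboveI2[where M = M])
qed

lemma alex_norm_le: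
  assumes "a < b" "F \<in> C0 a b" "\<And>x. x \<in> {a..b} \<Longrightarrow> \<bar>F x\<bar> \<le> M"
  shows "alex_norm a b (distD a b F) \<le> M"
  unfolding alex_norm_distD[OF assms(1,2)] using assms by (intro cSUP_least) auto

lemma alex_norm_nonneg:
  assumes "a < b" "F \<in> C0 a b"
  shows "0 \<le> alex_norm a b (distD a b F)"
  using abs_le_alex_norm[OF assms, of a] assms(1) by (auto intro: order_trans[OF abs_ge_zero])

lemma L1_approx:
  assumes ab: "a < b" and F: "F \<in> C0 a b" and e: "0 < e"
  obtains g where "g \<in> L1 a b" "alex_norm a b (dminus (embed a b g) (distD a b F)) \<le> e"
proof -
  have cF: "continuous_on {a..b} F" and Fa: "F a = 0" using F by (auto simp: C0_def)
  \<comment> \<open>The derivative of \<open>P\<close> has primitive P - P a. Since F a = 0, the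
    shift by P a costs a second e / 2.\<close>
  obtain P where P: "real_polynomial_function P" "\<And>x. x \<in> {a..b} \<Longrightarrow> \<bar>F x - P x\<bar> < e / 2"
    using Stone_Weierstrass_real_polynomial_function[of "{a..b}" F "e / 2"] cF e
    by (metis compact_Icc half_gt_zero)
  obtain g where g: "real_polynomial_function g" "\<And>x. (P has_real_derivative g x) (at x)"
    using has_real_derivative_polynomial_function[OF P(1)] by metis
  have "continuous_on {a..b} g"
    using g(1) by (intro continuous_on_polymonial_function) (simp add: real_polynomial_function_eq)
  then have gL: "g \<in> L1 a b"
    by (simp add: L1_def absolutely_integrable_continuous_real)
  have J: "RL_L1 a b 1 g x = P x - P a" if "x \<in> {a..b}" for x
  proof -
    have "(g has_integral (P x - P a)) {a..x}"
      using that by (intro fundamental_theorem_of_calculus)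
        (auto intro!: has_field_derivative_at_within[OF g(2)] simp flip: has_real_derivative_iff_has_vector_derivative)
    then show ?thesis using that by (simp add: RL_L1_1 integral_unique)
  qed
  have "alex_norm a b (dminus (embed a b g) (distD a b F)) \<le> e"
    unfolding embed_eq_distD[OF ab gL] dminus_distD[OF RL_L1_1_in_C0[OF gL] F]
  proof (rule alex_norm_le[OF ab C0_diff[OF RL_L1_1_in_C0[OF gL] F]])
    fix x assume x: "x \<in> {a..b}"
    have "\<bar>P x - P a - F x\<bar> \<le> \<bar>F x - P x\<bar> + \<bar>F a - P a\<bar>" using Fa by linarith
    also have "\<dots> \<le> e" using P(2)[OF x] P(2)[of a] ab by force
    finally show "\<bar>RL_L1 a b 1 g x - F x\<bar> \<le> e" using J[OF x] by simp
  qed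
  with gL that show thesis by blast
qed

lemma L1_approx_sequence:
  assumes ab: "a < b" and F: "F \<in> C0 a b"
  obtains fk :: "nat \<Rightarrow> real \<Rightarrow> real" where "\<And>k. fk k \<in> L1 a b"
    "(\<lambda>k. alex_norm a b (dminus (embed a b (fk k)) (distD a b F))) \<longlonglongrightarrow> 0"
proof -
  have "\<exists>g. g \<in> L1 a b \<and> alex_norm a b (dminus (embed a b g) (distD a b F)) \<le> inverse (real (Suc k))" for k
    using L1_approx[OF ab F, of "inverse (real (Suc k))"] by (metis inverse_positive_iff_positive of_nat_0_less_iff zero_less_Suc)
  then obtain fk where fk: "\<And>k. fk k \<in> L1 a b"
    "\<And>k. alex_norm a b (dminus (embed a b (fk k)) (distD a b F)) \<le> inverse (real (Suc k))"
    by metis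
  have "0 \<le> alex_norm a b (dminus (embed a b (fk k)) (distD a b F))" for k
    unfolding embed_eq_distD[OF ab fk(1)] dminus_distD[OF RL_L1_1_in_C0[OF fk(1)] F]
    by (intro alex_norm_nonneg ab C0_diff RL_L1_1_in_C0 fk(1) F)
  then have "(\<lambda>k. alex_norm a b (dminus (embed a b (fk k)) (distD a b F))) \<longlonglongrightarrow> 0"
    using fk(2) by (intro tendsto_sandwich[OF _ _ tendsto_const LIMSEQ_inverse_real_of_nat]) auto
  with fk(1) that show thesis by blast
qed

lemma alex_norm_RL_L1_tendsto:
  assumes ab: "a < b" and n: "0 < n" and F: "F \<in> C0 a b" and fk: "\<And>k. fk k \<in> L1 a b"
    and lim: "(\<lambda>k. alex_norm a b (dminus (embed a b (fk k)) (distD a b F))) \<longlonglongrightarrow> 0"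
  shows "(\<lambda>k. alex_norm a b (dminus (embed a b (RL_L1 a b n (fk k))) (distD a b (RL_L1 a b n F)))) \<longlonglongrightarrow> 0"
proof -
  define D where "D k x = RL_L1 a b 1 (fk k) x - F x" for k x
  have J1: "RL_L1 a b 1 (fk k) \<in> C0 a b" for k
    by (rule RL_L1_1_in_C0[OF fk])
  have D: "D k \<in> C0 a b" for k
    unfolding D_def by (intro C0_diff J1 F)
  have eqD: "dminus (embed a b (fk k)) (distD a b F) = distD a b (D k)" for k
    unfolding embed_eq_distD[OF ab fk] dminus_distD[OF J1 F] D_def ..
  have eq: "dminus (embed a b (RL_L1 a b n (fk k))) (distD a b (RL_L1 a b n F)) = distD a b (RL_L1 a b n (D k))" for k
  proof -
    have L: "RL_L1 a b n (fk k) \<in> L1 a b" by (rule RL_L1_in_L1[OF n fk])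
    have "RL_L1 a b 1 (RL_L1 a b n (fk k)) x - RL_L1 a b n F x = RL_L1 a b n (D k) x" if "x \<in> {a..b}" for x
    proof -
      \<comment> \<open>Either order of composition has total order n + 1 >= 1, so the composition
        law for L1 functions holds at each point of \<open>{a..b}\<close>, however small n
        is.\<close>
      have "RL_L1 a b 1 (RL_L1 a b n (fk k)) x = RL_L1 a b n (RL_L1 a b 1 (fk k)) x"
        using n that fk by (simp add: RL_L1_RL_L1_L1 add.commute)
      moreover have "RL_L1 a b n (D k) x = RL_L1 a b n (RL_L1 a b 1 (fk k)) x - RL_L1 a b n F x"
        unfolding D_def using n J1[of k] F that by (intro RL_L1_diff) (auto simp: C0_def)
      ultimately show ?thesis by simp
    qed
    then show ?thesis
      unfolding embed_eq_distD[OF ab L] dminus_distD[OF RL_L1_1_in_C0[OF L] RL_L1_in_C0[OF n F]]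
      by (rule distD_cong)
  qed
  let ?K = "frac_kernel (n + 1) (b - a)"
  have "alex_norm a b (distD a b (RL_L1 a b n (D k))) \<le> alex_norm a b (distD a b (D k)) * ?K" for k
    using D[of k] ab n
    by (intro alex_norm_le RL_L1_in_C0 abs_RL_L1_le alex_norm_nonneg abs_le_alex_norm) (auto simp: C0_def)
  then have le: "norm (alex_norm a b (distD a b (RL_L1 a b n (D k)))) \<le> alex_norm a b (distD a b (D k)) * ?K" for k
    using alex_norm_nonneg[OF ab RL_L1_in_C0[OF n D[of k]]] by simp
  have "(\<lambda>k. alex_norm a b (distD a b (D k)) * ?K) \<longlonglongrightarrow> 0"
    using tendsto_mult[OF lim tendsto_const[of ?K]] unfolding eqD by simp
  with always_eventually[OF allI[OF le]] show ?thesis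
    unfolding eq by (rule Lim_null_comparison)
qed

text \<open>Convergence in the norm is uniform convergence of primitives, and pointwise limits are
  unique.\<close>

lemma alex_norm_limit_unique:
  assumes ab: "a < b" and E: "\<And>k. E k \<in> C0 a b" and G: "G \<in> C0 a b" and H: "H \<in> C0 a b"
    and limG: "(\<lambda>k. alex_norm a b (dminus (distD a b (E k)) (distD a b G))) \<longlonglongrightarrow> 0"
    and limH: "(\<lambda>k. alex_norm a b (dminus (distD a b (E k)) (distD a b H))) \<longlonglongrightarrow> 0"
  shows "distD a b G = distD a b H"
proof (rule distD_cong)
  fix x assume x: "x \<in> {a..b}"
  have conv: "(\<lambda>k. E k x) \<longlonglongrightarrow> F x"
    if F: "F \<in> C0 a b" and lim: "(\<lambda>k. alex_norm a b (dminus (distD a b (E k)) (distD a b F))) \<longlonglongrightarrow> 0" for F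
  proof -
    have "\<bar>E k x - F x\<bar> \<le> alex_norm a b (dminus (distD a b (E k)) (distD a b F))" for k
      unfolding dminus_distD[OF E F] by (rule abs_le_alex_norm[OF ab C0_diff[OF E F] x])
    then have "(\<lambda>k. E k x - F x) \<longlonglongrightarrow> 0"
      by (intro Lim_null_comparison[OF _ lim]) auto
    then show ?thesis by (simp add: LIM_zero_iff)
  qed
  show "G x = H x"
    using LIMSEQ_unique conv[OF G limG] conv[OF H limH] by blast
qed

section \<open>Transfer to primitives and the semigroup law\<close>

text \<open>Order 0 is split off because \<open>Gamma 0\<close> is 0, so \<open>RL_L1 a b 0\<close>
  would be the zero map instead of the identity.\<close>

definition frac_int :: "real \<Rightarrow> real \<Rightarrow> real \<Rightarrow> (real \<Rightarrow> real) \<Rightarrow> real \<Rightarrow> real" where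
  "frac_int a b p F = (if p = 0 then F else RL_L1 a b p F)"

lemma frac_int_in_C0: "0 \<le> p \<Longrightarrow> F \<in> C0 a b \<Longrightarrow> frac_int a b p F \<in> C0 a b"
  by (simp add: frac_int_def RL_L1_in_C0)

lemma frac_int_frac_int:
  assumes "0 \<le> p" "0 \<le> q" "F \<in> C0 a b" "x \<in> {a..b}"
  shows "frac_int a b p (frac_int a b q F) x = frac_int a b (p + q) F x"
  using assms RL_L1_RL_L1_continuous[of p q a b F x]
  by (cases "p = 0"; cases "q = 0") (simp_all add: frac_int_def C0_def)

lemma RL_fun_distD:
  assumes ab: "a < b" and n: "1 \<le> n" and F: "F \<in> C0 a b" and x: "x \<in> {a..b}"
  shows "RL_fun a b n (distD a b F) x = frac_int a b (n - 1) F x"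
proof (cases "n = 1")
  case True
  then show ?thesis
    by (simp only: RL_fun_1[OF distD_in_DHK[OF F]] primitive_distD[OF ab F x] frac_int_def diff_self if_True simp_thms)
next
  case False
  with n have n: "1 < n" by simp
  have "RL_fun a b n (distD a b F) x = RL_L1 a b (n - 1) (primitive a b (distD a b F)) x"
    by (rule RL_fun_gt_1[OF n distD_in_DHK[OF F] x])
  also have "\<dots> = RL_L1 a b (n - 1) F x"
    by (rule RL_L1_cong[OF primitive_distD[OF ab F] x])
  finally show ?thesis using n by (simp add: frac_int_def)
qed

lemma embed_cong:
  assumes "\<And>x. x \<in> {a..b} \<Longrightarrow> g x = h x"
  shows "embed a b g = embed a b h"
  unfolding embed_def by (intro ext if_cong refl integral_cong) (simp add: assms)

lemma RL_distD:
  assumes ab: "a < b" and n: "0 \<le> n" and F: "F \<in> C0 a b"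
  shows "RL a b n (distD a b F) = distD a b (frac_int a b n F)"
proof -
  consider "n = 0" | "1 \<le> n" | "0 < n" "n < 1" using n by linarith
  then show ?thesis
  proof cases
    case 1
    then show ?thesis by (simp add: RL_def frac_int_def)
  next
    case 2
    have C: "frac_int a b (n - 1) F \<in> C0 a b"
      using 2 F by (intro frac_int_in_C0) auto
    have "RL a b n (distD a b F) = embed a b (RL_fun a b n (distD a b F))"
      using 2 by (simp add: RL_def)
    also have "\<dots> = embed a b (frac_int a b (n - 1) F)"
      by (rule embed_cong) (rule RL_fun_distD[OF ab 2 F])
    \<comment> \<open>The function has order n - 1; passing to its primitive adds the missing order
      1.\<close>
    also have "\<dots> = distD a b (frac_int a b 1 (frac_int a b (n - 1) F))"
      unfolding embed_eq_distD[OF ab C0_in_L1[OF C]] by (simp add: frac_int_def[of a b 1])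
    also have "\<dots> = distD a b (frac_int a b n F)"
      using 2 F by (intro distD_cong) (simp add: frac_int_frac_int)
    finally show ?thesis .
  next
    case 3
    let ?h = "distD a b (RL_L1 a b n F)"
    have C: "RL_L1 a b n F \<in> C0 a b" by (rule RL_L1_in_C0[OF 3(1) F])
    have "RL a b n (distD a b F) = (THE h. h \<in> DHK a b \<and>
        (\<forall>fk :: nat \<Rightarrow> real \<Rightarrow> real.
           (\<forall>k. fk k \<in> L1 a b) \<and>
           (\<lambda>k. alex_norm a b (dminus (embed a b (fk k)) (distD a b F))) \<longlonglongrightarrow> 0 \<longrightarrow>
           (\<lambda>k. alex_norm a b (dminus (embed a b (RL_L1 a b n (fk k))) h)) \<longlonglongrightarrow> 0))"
      using 3 by (simp add: RL_def)
    also have "\<dots> = ?h"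
    proof (rule the_equality)
      show "?h \<in> DHK a b \<and>
        (\<forall>fk :: nat \<Rightarrow> real \<Rightarrow> real.
           (\<forall>k. fk k \<in> L1 a b) \<and>
           (\<lambda>k. alex_norm a b (dminus (embed a b (fk k)) (distD a b F))) \<longlonglongrightarrow> 0 \<longrightarrow>
           (\<lambda>k. alex_norm a b (dminus (embed a b (RL_L1 a b n (fk k))) ?h)) \<longlonglongrightarrow> 0)"
        using distD_in_DHK[OF C] alex_norm_RL_L1_tendsto[OF ab 3(1) F] by blast
    next
      fix h
      assume h: "h \<in> DHK a b \<and>
        (\<forall>fk :: nat \<Rightarrow> real \<Rightarrow> real.
           (\<forall>k. fk k \<in> L1 a b) \<and>
           (\<lambda>k. alex_norm a b (dminus (embed a b (fk k)) (distD a b F))) \<longlonglongrightarrow> 0 \<longrightarrow>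
           (\<lambda>k. alex_norm a b (dminus (embed a b (RL_L1 a b n (fk k))) h)) \<longlonglongrightarrow> 0)"
      then obtain H where H: "H \<in> C0 a b" "h = distD a b H"
        by (auto simp: DHK_def)
      \<comment> \<open>The condition on \<open>h\<close> is universal over approximating sequences,
        so it determines \<open>h\<close> only once such a sequence is exhibited.\<close>
      obtain fk :: "nat \<Rightarrow> real \<Rightarrow> real" where fk: "\<And>k. fk k \<in> L1 a b"
        "(\<lambda>k. alex_norm a b (dminus (embed a b (fk k)) (distD a b F))) \<longlonglongrightarrow> 0"
        using L1_approx_sequence[OF ab F] by metis
      have L: "RL_L1 a b n (fk k) \<in> L1 a b" for k by (rule RL_L1_in_L1[OF 3(1) fk(1)])
      have "(\<lambda>k. alex_norm a b (dminus (embed a b (RL_L1 a b n (fk k))) (distD a b H))) \<longlonglongrightarrow> 0"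
        using h fk H by blast
      moreover have "(\<lambda>k. alex_norm a b (dminus (embed a b (RL_L1 a b n (fk k))) ?h)) \<longlonglongrightarrow> 0"
        by (rule alex_norm_RL_L1_tendsto[OF ab 3(1) F fk])
      ultimately have "distD a b H = ?h"
        unfolding embed_eq_distD[OF ab L]
        by (intro alex_norm_limit_unique[OF ab RL_L1_1_in_C0[OF L] H(1) C])
      with H show "h = ?h" by simp
    qed
    finally show ?thesis using 3 by (simp add: frac_int_def)
  qed
qed

lemma RL_in_DHK:
  assumes "a < b" "0 \<le> p" "f \<in> DHK a b"
  shows "RL a b p f \<in> DHK a b"
proof -
  obtain F where F: "F \<in> C0 a b" "f = distD a b F"
    using assms(3) by (auto simp: DHK_def)
  then show ?thesis
    by (simp only: RL_distD[OF assms(1,2)] distD_in_DHK frac_int_in_C0 assms(2))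
qed

lemma RL_RL:
  assumes "a < b" "0 \<le> p" "0 \<le> q" "f \<in> DHK a b"
  shows "RL a b p (RL a b q f) = RL a b (p + q) f"
proof -
  obtain F where F: "F \<in> C0 a b" "f = distD a b F"
    using assms(4) by (auto simp: DHK_def)
  then show ?thesis
    using assms by (auto simp: RL_distD frac_int_in_C0 frac_int_frac_int intro: distD_cong)
qed

theorem theorem3p4:
  fixes a b m n :: real and f :: distr
  assumes ab: "a < b"
    and m: "0 \<le> m" and n: "0 \<le> n"
    and f: "f \<in> DHK a b"
  shows
    \<comment> \<open>(i)\<close>
    "RL a b m (RL a b n f) = RL a b (m + n) f
     \<and> ((1 \<le> m \<or> 1 \<le> n) \<longrightarrow> continuous_on {a..b} (RL_fun a b (m + n) f))
     \<and> (1 \<le> m \<longrightarrow> (\<forall>x\<in>{a..b}. RL_fun a b m (RL a b n f) x = RL_fun a b (m + n) f x))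
     \<and> (1 \<le> n \<and> 0 < m \<longrightarrow>
          (\<forall>x\<in>{a..b}. RL_L1 a b m (RL_fun a b n f) x = RL_fun a b (m + n) f x))
     \<and> (1 \<le> n \<and> m = 0 \<longrightarrow> (\<forall>x\<in>{a..b}. RL_fun a b n f x = RL_fun a b (m + n) f x))
     \<comment> \<open>(ii)\<close>
     \<and> RL a b m (RL a b n f) = RL a b n (RL a b m f)
     \<comment> \<open>(iii)\<close>
     \<and> (\<forall>p q. 0 \<le> p \<longrightarrow> 0 \<le> q \<longrightarrow>
          (\<forall>g\<in>DHK a b. RL a b p g \<in> DHK a b)
          \<and> (\<exists>r\<ge>0. \<forall>g\<in>DHK a b. RL a b p (RL a b q g) = RL a b r g)
          \<and> (\<forall>g\<in>DHK a b. RL a b p (RL a b q g) = RL a b q (RL a b p g)))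
     \<and> (\<forall>p\<ge>0. \<forall>g\<in>DHK a b. RL a b 0 (RL a b p g) = RL a b p g \<and> RL a b p (RL a b 0 g) = RL a b p g)"
proof (intro conjI)
  obtain F where F: "F \<in> C0 a b" and fF: "f = distD a b F"
    using f by (auto simp: DHK_def)
  have RLf: "RL_fun a b p f x = frac_int a b (p - 1) F x" if "1 \<le> p" "x \<in> {a..b}" for p x
    unfolding fF by (rule RL_fun_distD[OF ab that(1) F that(2)])
  show "RL a b m (RL a b n f) = RL a b (m + n) f"
    by (rule RL_RL[OF ab m n f])
  show "(1 \<le> m \<or> 1 \<le> n) \<longrightarrow> continuous_on {a..b} (RL_fun a b (m + n) f)"
  proof
    assume "1 \<le> m \<or> 1 \<le> n"
    then have mn: "1 \<le> m + n" using m n by linarith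
    then have "continuous_on {a..b} (frac_int a b (m + n - 1) F)"
      using frac_int_in_C0[of "m + n - 1" F a b] F by (simp add: C0_def)
    then show "continuous_on {a..b} (RL_fun a b (m + n) f)"
      by (rule continuous_on_eq) (simp add: RLf mn)
  qed
  show "1 \<le> m \<longrightarrow> (\<forall>x\<in>{a..b}. RL_fun a b m (RL a b n f) x = RL_fun a b (m + n) f x)"
  proof (intro impI ballI)
    fix x assume m1: "1 \<le> m" and x: "x \<in> {a..b}"
    \<comment> \<open>Count orders: the primitive of the inner distribution has order n, and
      evaluating the outer operator as a function adds m - 1.\<close>
    have "RL_fun a b m (RL a b n f) x = frac_int a b (m - 1) (frac_int a b n F) x"
      using fF RL_fun_distD[OF ab m1 frac_int_in_C0[OF n F] x] by (simp add: RL_distD ab n F)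
    also have "\<dots> = frac_int a b (m + n - 1) F x"
      using frac_int_frac_int[OF _ n F x, of "m - 1"] m1 by (simp add: algebra_simps)
    finally show "RL_fun a b m (RL a b n f) x = RL_fun a b (m + n) f x"
      using m1 n x by (simp add: RLf)
  qed
  show "1 \<le> n \<and> 0 < m \<longrightarrow> (\<forall>x\<in>{a..b}. RL_L1 a b m (RL_fun a b n f) x = RL_fun a b (m + n) f x)"
  proof (intro impI ballI, elim conjE)
    fix x assume n1: "1 \<le> n" and m0: "0 < m" and x: "x \<in> {a..b}"
    \<comment> \<open>Here the inner operator already gives a continuous function, of order n - 1,
      so the outer one is an ordinary integral that adds the full order m.\<close>
    have "RL_L1 a b m (RL_fun a b n f) x = frac_int a b m (frac_int a b (n - 1) F) x"
      using RL_L1_cong[OF RLf[OF n1] x, where p = m] m0 by (simp add: frac_int_def)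
    also have "\<dots> = frac_int a b (m + n - 1) F x"
      using frac_int_frac_int[OF m _ F x, of "n - 1"] n1 by (simp add: algebra_simps)
    finally show "RL_L1 a b m (RL_fun a b n f) x = RL_fun a b (m + n) f x"
      using n1 m x by (simp add: RLf)
  qed
  show "1 \<le> n \<and> m = 0 \<longrightarrow> (\<forall>x\<in>{a..b}. RL_fun a b n f x = RL_fun a b (m + n) f x)"
    by simp
  show "RL a b m (RL a b n f) = RL a b n (RL a b m f)"
    using RL_RL[OF ab m n f] RL_RL[OF ab n m f] by (simp add: add.commute)
  show "\<forall>p q. 0 \<le> p \<longrightarrow> 0 \<le> q \<longrightarrow>
          (\<forall>g\<in>DHK a b. RL a b p g \<in> DHK a b)
          \<and> (\<exists>r\<ge>0. \<forall>g\<in>DHK a b. RL a b p (RL a b q g) = RL a b r g)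
          \<and> (\<forall>g\<in>DHK a b. RL a b p (RL a b q g) = RL a b q (RL a b p g))"
  proof (intro allI impI conjI ballI)
    fix p q :: real and g
    assume p: "0 \<le> p" and q: "0 \<le> q"
    show "\<exists>r\<ge>0. \<forall>g\<in>DHK a b. RL a b p (RL a b q g) = RL a b r g"
      using p q by (intro exI[of _ "p + q"]) (simp add: RL_RL ab)
    assume g: "g \<in> DHK a b"
    show "RL a b p g \<in> DHK a b" by (rule RL_in_DHK[OF ab p g])
    show "RL a b p (RL a b q g) = RL a b q (RL a b p g)"
      using p q g by (simp add: RL_RL ab add.commute)
  qed
  show "\<forall>p\<ge>0. \<forall>g\<in>DHK a b. RL a b 0 (RL a b p g) = RL a b p g \<and> RL a b p (RL a b 0 g) = RL a b p g"
    by (simp add: RL_def[of a b 0])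
qed

end
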